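(* Let $n \ge 5$ and let $Q_0 = Q_0(n)$ be the standard tableau of shape $(n-3,2,1)$ with first row $1, 3, 6, 7, 8, \dots, n$, second row $2, 5$, and third row $4$. Then: (i) $\mathrm{sst}(Q_0)=0$; (ii) $\mathrm{sst}(\sigma_2(Q_0))=1$; (iii) $\mathrm{sst}(\sigma_k \cdots \sigma_5\sigma_4\sigma_2(Q_0)) = k-2$ for each $k = 4,5,\dots,n-1$. Furthermore, each of the tableaux $Q_0$, $\sigma_2(Q_0)$, and $\sigma_k\cdots\sigma_5\sigma_4\sigma_2(Q_0)$ ($4\le k\le n-1$) is (BBS) good.
   Context: Bender--Knuth involutions: for a standard tableau $T$ of size $n$ and $i\in\{1,\dots,n-1\}$, if $i$ and $i+1$ are in the same row or the same column of $T$ then $\sigma_i(T)=T$; otherwise $\sigma_i(T)$ is obtained from $T$ by swapping $i$ and $i+1$. The product $\sigma_k\cdots\sigma_5\sigma_4\sigma_2$ means apply $\sigma_2$ first, then $\sigma_4,\sigma_5,\dots,\sigma_k$ in this order (for $k=4$ it is $\sigma_4\sigma_2$). Box-ball system (BBS). Boxes are indexed by $\mathbb{Z}$ from left to right. A BBS configuration (with $n$ balls) is a sequence $X$ indexed by $\mathbb{Z}$ in which each of $1,\dots,n$ (the balls) appears exactly once and every other entry is $e := n+1$ (an empty box). One BBS move transforms $X$ into $\mathrm{BB}(X)$: the balls $1,2,\dots,n$, in this order, each jump once, to the nearest box to the right of the ball that is empty at that moment (the box a ball leaves becomes empty). $\mathrm{BB}^t(X)$ is the result of $t$ BBS moves.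 A permutation $w = w_1\cdots w_n \in S_n$ (one-line notation) is regarded as the configuration with ball $w_i$ in box $i$ for $1\le i\le n$ and all other boxes empty. An increasing run of a configuration is a maximal contiguous (occupying consecutive boxes) increasing nonempty sequence of balls. A soliton is an increasing run that is preserved by all subsequent BBS moves (it remains an increasing run in all later configurations). A configuration is in steady state if every ball is contained in a soliton. Every box-ball system reaches steady state after finitely many moves, and then the sizes of the solitons weakly increase from left to right. The steady-state time of $w$ is the least $t\ge 0$ such that $\mathrm{BB}^t(w)$ is in steady state. The soliton decomposition $\mathrm{SD}(w)$ is the tableau whose first (top) row is the rightmost soliton of a steady-state configuration $\mathrm{BB}^t(w)$, whose second row is the second rightmost soliton, and so on. A permutation $w$ is good if $\mathrm{SD}(w)$ is a standard tableau (increasing rows and columns). Let $Q(w)$ be the Robinson--Schensted recording tableau of $w$. Permutations with the same recording tableau have the same steady-state time, and are either all good or all not good. For a standard tableau $T$, $\mathrm{sst}(T)$ denotes the common steady-state time of all permutations $w$ with $Q(w)=T$, and $T$ is called (BBS) good if $Q(w)=T$ implies $w$ is good (equivalently, $Q(w)=T$ for some good $w$). *)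

theory Defs
  imports "HOL-Combinatorics.Multiset_Permutations" "HOL-Combinatorics.Transposition"
begin

text \<open>A tableau is the list of its rows, top row first; permutations are lists in
  one-line notation.\<close>

type_synonym tableau = "nat list list"

definition standard_tableau :: "tableau \<Rightarrow> bool" where
  "standard_tableau T \<longleftrightarrow>
     [] \<notin> set T \<and> sorted_wrt (\<ge>) (map length T) \<and>
     concat T \<in> permutations_of_set {1..length (concat T)} \<and>
     (\<forall>r\<in>set T. sorted_wrt (<) r) \<and>
     (\<forall>i j. Suc i < length T \<and> j < length (T ! Suc i) \<longrightarrow> T ! i ! j < T ! Suc i ! j)"

definition same_row :: "tableau \<Rightarrow> nat \<Rightarrow> nat \<Rightarrow> bool" where
  "same_row T a b \<longleftrightarrow> (\<exists>r\<in>set T. a \<in> set r \<and> b \<in> set r)"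

definition same_column :: "tableau \<Rightarrow> nat \<Rightarrow> nat \<Rightarrow> bool" where
  "same_column T a b \<longleftrightarrow>
     (\<exists>r\<in>set T. \<exists>s\<in>set T. \<exists>c. c < length r \<and> c < length s \<and> r ! c = a \<and> s ! c = b)"

definition bender_knuth :: "nat \<Rightarrow> tableau \<Rightarrow> tableau" where
  "bender_knuth i T =
     (if same_row T i (i + 1) \<or> same_column T i (i + 1) then T
      else map (map (Transposition.transpose i (i + 1))) T)"

definition permutation :: "nat list \<Rightarrow> bool" where
  "permutation w \<longleftrightarrow> w \<in> permutations_of_set {1..length w}"


subsection \<open>Robinson--Schensted correspondence\<close>

text \<open>The pair of insertion and recording tableau is kept as a list of pairs of
  corresponding rows. \<open>rs_insert m x\<close> inserts \<open>x\<close> by row insertion (the leftmost entry of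
  a row that is larger than \<open>x\<close> is bumped into the next row) and records \<open>m\<close> in the new cell.\<close>

fun rs_insert :: "nat \<Rightarrow> nat \<Rightarrow> (nat list \<times> nat list) list \<Rightarrow> (nat list \<times> nat list) list" where
  "rs_insert m x [] = [([x], [m])]"
| "rs_insert m x ((p, q) # rows) =
     (case dropWhile (\<lambda>y. y < x) p of
        [] \<Rightarrow> (p @ [x], q @ [m]) # rows
      | y # ys \<Rightarrow> (takeWhile (\<lambda>y. y < x) p @ x # ys, q) # rs_insert m y rows)"

definition recording_tableau :: "nat list \<Rightarrow> tableau" where
  "recording_tableau w = map snd (fold (\<lambda>(m, x). rs_insert m x) (enumerate 1 w) [])"


subsection \<open>The box-ball system\<close>

text \<open>A configuration with \<open>n\<close> balls assigns to every box its content, where \<open>n + 1\<close> stands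
  for an empty box.\<close>

type_synonym config = "int \<Rightarrow> nat"

definition config_of :: "nat list \<Rightarrow> config" where
  "config_of w k = (if 1 \<le> k \<and> k \<le> int (length w) then w ! nat (k - 1) else length w + 1)"

definition jump :: "nat \<Rightarrow> nat \<Rightarrow> config \<Rightarrow> config" where
  "jump n i X =
     (let p = (THE p. X p = i); q = (LEAST q. p < q \<and> X q = n + 1)
      in X(p := n + 1, q := i))"

definition BB :: "nat \<Rightarrow> config \<Rightarrow> config" where
  "BB n X = fold (jump n) [1..<n + 1] X"

text \<open>Contiguous increasing sequences of balls and increasing runs, given by the first and
  last box they occupy.\<close>

definition increasing_at :: "nat \<Rightarrow> config \<Rightarrow> int \<Rightarrow> int \<Rightarrow> bool" where
  "increasing_at n X a b \<longleftrightarrow>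
     a \<le> b \<and> (\<forall>k\<in>{a..b}. X k \<in> {1..n}) \<and> strict_mono_on {a..b} X"

definition run_at :: "nat \<Rightarrow> config \<Rightarrow> int \<Rightarrow> int \<Rightarrow> bool" where
  "run_at n X a b \<longleftrightarrow>
     increasing_at n X a b \<and>
     (\<forall>a' b'. increasing_at n X a' b' \<and> {a..b} \<subseteq> {a'..b'} \<longrightarrow> a' = a \<and> b' = b)"

text \<open>As sequences of balls, runs are independent of their position, which changes under
  \<open>BB\<close>.\<close>

definition increasing_run :: "nat \<Rightarrow> config \<Rightarrow> nat list \<Rightarrow> bool" where
  "increasing_run n X s \<longleftrightarrow> (\<exists>a b. run_at n X a b \<and> s = map X [a..b])"

definition soliton :: "nat \<Rightarrow> config \<Rightarrow> nat list \<Rightarrow> bool" where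
  "soliton n X s \<longleftrightarrow> (\<forall>t. increasing_run n ((BB n ^^ t) X) s)"

definition steady_state :: "nat \<Rightarrow> config \<Rightarrow> bool" where
  "steady_state n X \<longleftrightarrow> (\<forall>i\<in>{1..n}. \<exists>s. soliton n X s \<and> i \<in> set s)"

definition steady_state_time :: "nat list \<Rightarrow> nat" where
  "steady_state_time w = (LEAST t. steady_state (length w) ((BB (length w) ^^ t) (config_of w)))"

definition solitons_right_to_left :: "nat \<Rightarrow> config \<Rightarrow> nat list list" where
  "solitons_right_to_left n X =
     map (\<lambda>(a, b). map X [a..b])
       (rev (sorted_key_list_of_set fst {(a, b). run_at n X a b \<and> soliton n X (map X [a..b])}))"

text \<open>The soliton decomposition does not depend on the choice of a steady-state
  configuration; the first one is used here.\<close>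

definition soliton_decomposition :: "nat list \<Rightarrow> tableau" where
  "soliton_decomposition w =
     solitons_right_to_left (length w) ((BB (length w) ^^ steady_state_time w) (config_of w))"

definition good_permutation :: "nat list \<Rightarrow> bool" where
  "good_permutation w \<longleftrightarrow> standard_tableau (soliton_decomposition w)"

text \<open>The common value: \<open>sst T\<close> is unspecified unless all permutations with recording tableau
  \<open>T\<close> have the same steady-state time and at least one such permutation exists.\<close>

definition sst :: "tableau \<Rightarrow> nat" where
  "sst T = (THE t. steady_state_time ` {w. permutation w \<and> recording_tableau w = T} = {t})"

definition good_tableau :: "tableau \<Rightarrow> bool" where
  "good_tableau T \<longleftrightarrow>
     standard_tableau T \<and>
     (\<forall>w. permutation w \<and> recording_tableau w = T \<longrightarrow> good_permutation w)"

definition Q0 :: "nat \<Rightarrow> tableau" where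
  "Q0 n = [1 # 3 # [6..<n + 1], [2, 5], [4]]"

definition bender_knuth_product :: "nat \<Rightarrow> tableau \<Rightarrow> tableau" where
  "bender_knuth_product k T = fold bender_knuth (2 # [4..<k + 1]) T"

end

theory Submission
  imports Defs
begin

text \<open>For each of the tableaux, the words with this recording tableau are described by inequalities
  between their letters, and these inequalities determine the motion of the balls.

  The words for \<open>Q\<^sub>0\<close> are the row reading words \<open>x y z d\<close> of the standard tableaux with rows \<open>d\<close>,
  \<open>[y, z]\<close> and \<open>[x]\<close> (\<open>recording_Q0_iff\<close>). The three rows are solitons from the start: they move
  at speeds \<open>n - 3\<close>, 2 and 1, the fastest one in front, and where two of them touch, the column
  conditions of the tableau keep them out of each other's way (\<open>BB_standard\<close>).

  The words for \<open>\<sigma>\<^sub>k \<dots> \<sigma>\<^sub>5 \<sigma>\<^sub>4 \<sigma>\<^sub>2 (Q\<^sub>0)\<close> have three increasing runs \<open>[a, b]\<close>, \<open>v1 c v2\<close> and \<open>x xs\<close>, of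
  lengths \<open>2\<close>, \<open>k - 2\<close> and \<open>n - k\<close>, where row insertion of \<open>x\<close> bumps \<open>c\<close>
  (\<open>three_run_word_if_recording_Q_chain\<close>, \<open>recording_Q_chain_if_three_run_word\<close>). The first move imitates
  the row insertion (\<open>BB_three_run_word\<close>): the pair \<open>a b\<close> lands in boxes 3 and 4, the ball \<open>c\<close> in box \<open>k + 1\<close>,
  and the first row \<open>d\<close> of the insertion tableau in boxes \<open>n + 1, \<dots>, 2n - 3\<close>. From now on \<open>d\<close> runs
  ahead, and the pair, of speed 2, chases the single ball \<open>c\<close>, of speed 1. After \<open>k - 3\<close> moves it
  stands right behind \<open>c\<close>, and the next move inserts \<open>c\<close> into the row \<open>a b\<close>: one of the two balls is
  bumped and stays behind, and the other one forms a new pair with \<open>c\<close> (\<open>collision\<close>). Now the blocks are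
  the rows of a standard tableau in steady order, while \<open>a\<close> and \<open>b\<close>, adjacent before, have been
  torn apart; so the steady state is reached after exactly \<open>k - 2\<close> moves. Words for \<open>\<sigma>\<^sub>2 (Q\<^sub>0)\<close> are the
  case in which the collision happens in the very first move (\<open>recording_Q2_iff\<close>).

  In all cases the soliton decomposition is the standard tableau formed by the final three
  blocks, so the tableaux are good.\<close>

section \<open>One move, ball by ball\<close>

definition ball_config :: "nat \<Rightarrow> config \<Rightarrow> bool" where
  "ball_config n X \<longleftrightarrow> (\<forall>k. X k \<in> {1..n + 1}) \<and> (\<forall>i\<in>{1..n}. \<exists>!k. X k = i)"

text \<open>The jump of ball \<open>i\<close> from its box \<open>p\<close> in \<open>X\<close> to its box \<open>q\<close> in \<open>Y\<close> is correct at the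
  moment when exactly the balls below \<open>i\<close> have jumped: \<open>q\<close> must not hold a ball that is still
  to jump, and each box in between must hold one or hold a ball that has just landed there.\<close>

definition jump_ok :: "nat \<Rightarrow> config \<Rightarrow> config \<Rightarrow> nat \<Rightarrow> bool" where
  "jump_ok n X Y i \<longleftrightarrow>
     (\<exists>p q. X p = i \<and> Y q = i \<and> p < q \<and> (X q = n + 1 \<or> X q < i) \<and>
        (\<forall>r. p < r \<and> r < q \<longrightarrow> (i < X r \<and> X r \<le> n) \<or> Y r < i))"

text \<open>The configuration in the middle of a move from \<open>X\<close> to \<open>Y\<close>, when the balls below \<open>i\<close> have
  jumped.\<close>

definition midway :: "nat \<Rightarrow> config \<Rightarrow> config \<Rightarrow> nat \<Rightarrow> config" where
  "midway n X Y i k = (if i \<le> X k \<and> X k \<le> n then X k else if Y k < i then Y k else n + 1)"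

lemma jump_midway:
  assumes X: "ball_config n X" and Y: "ball_config n Y"
    and ok: "\<And>j. j \<in> {1..n} \<Longrightarrow> jump_ok n X Y j" and i: "i \<in> {1..n}"
  shows "jump n i (midway n X Y i) = midway n X Y (i + 1)"
proof -
  obtain p q where pq: "X p = i" "Y q = i" "p < q" "X q = n + 1 \<or> X q < i"
    and btw: "\<And>r. p < r \<Longrightarrow> r < q \<Longrightarrow> (i < X r \<and> X r \<le> n) \<or> Y r < i"
    using ok[OF i] unfolding jump_ok_def by blast
  have uX: "k = p" if "X k = i" for k using X i that pq unfolding ball_config_def by metis
  have uY: "k = q" if "Y k = i" for k using Y i that pq unfolding ball_config_def by metis
  have in_le: "i \<le> n" using i by simp
  have THE_p: "(THE p. midway n X Y i p = i) = p"
  proof (rule the_equality)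
    show "midway n X Y i p = i" using pq in_le by (simp add: midway_def)
    show "k = p" if "midway n X Y i k = i" for k
      using that uX in_le by (auto simp: midway_def split: if_splits)
  qed
  have LEAST_q: "(LEAST q. p < q \<and> midway n X Y i q = n + 1) = q"
  proof (rule Least_equality)
    show "p < q \<and> midway n X Y i q = n + 1" using pq in_le by (auto simp: midway_def)
    fix r assume r: "p < r \<and> midway n X Y i r = n + 1"
    show "q \<le> r"
    proof (rule ccontr)
      assume "\<not> q \<le> r"
      with btw[of r] r in_le show False by (auto simp: midway_def split: if_splits)
    qed
  qed
  \<comment> \<open>A smaller ball landing in box \<open>p\<close> would have found ball \<open>i\<close> still there.\<close>
  have Yp: "\<not> Y p < i"
  proof
    assume less: "Y p < i"
    then have j: "Y p \<in> {1..n}" using Y in_le unfolding ball_config_def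
      by (metis atLeastAtMost_iff le_trans less_imp_le)
    obtain q' where "Y q' = Y p" "X q' = n + 1 \<or> X q' < Y p"
      using ok[OF j] unfolding jump_ok_def by blast
    moreover have "q' = p" using Y j \<open>Y q' = Y p\<close> unfolding ball_config_def by metis
    ultimately show False using less pq in_le by simp
  qed
  have "(midway n X Y i)(p := n + 1, q := i) = midway n X Y (i + 1)"
  proof
    fix k
    consider "k = p" | "k = q" | "X k \<noteq> i" "Y k \<noteq> i" "k \<noteq> p" "k \<noteq> q" using uX uY by blast
    then show "((midway n X Y i)(p := n + 1, q := i)) k = midway n X Y (i + 1) k"
    proof cases
      case 1
      have "Y p \<noteq> i" using uY pq by force
      then show ?thesis using 1 pq Yp by (auto simp: midway_def)
    next
      case 2 then show ?thesis using pq by (auto simp: midway_def)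
    next
      case 3 then show ?thesis by (auto simp: midway_def)
    qed
  qed
  then show ?thesis unfolding jump_def THE_p Let_def LEAST_q .
qed

text \<open>A move is a sequence of \<open>n\<close> nested updates, but to recognise its result it is enough to
  guess it and to check each ball separately. This replaces all simulation of jumps below.\<close>

lemma BB_eqI:
  assumes X: "ball_config n X" and Y: "ball_config n Y"
    and ok: "\<And>i. i \<in> {1..n} \<Longrightarrow> jump_ok n X Y i"
  shows "BB n X = Y"
proof -
  have "fold (jump n) [1..<Suc m] X = midway n X Y (Suc m)" if "m \<le> n" for m
    using that
  proof (induction m)
    case 0
    have "midway n X Y (Suc 0) k = X k" for k
    proof -
      have "X k \<in> {1..n+1}" "Y k \<in> {1..n+1}" using X Y unfolding ball_config_def by blast+
      then show ?thesis by (auto simp: midway_def)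
    qed
    then show ?case by auto
  next
    case (Suc m)
    then show ?case using jump_midway[OF X Y ok, of "Suc m"] by simp
  qed
  then have "BB n X = midway n X Y (n + 1)" by (simp add: BB_def)
  also have "\<dots> = Y"
  proof
    fix k
    have "Y k \<in> {1..n+1}" using Y unfolding ball_config_def by blast
    then show "midway n X Y (n + 1) k = Y k" by (auto simp: midway_def)
  qed
  finally show ?thesis .
qed

section \<open>Configurations made of blocks\<close>

definition segment :: "nat \<Rightarrow> int \<Rightarrow> nat list \<Rightarrow> config" where
  "segment n r d k = (if r \<le> k \<and> k < r + int (length d) then d ! nat (k - r) else n + 1)"

lemma config_of_eq_segment: "config_of w = segment (length w) 1 w"
  by (auto simp: config_of_def segment_def fun_eq_iff)

lemma segment_append:
  "segment n r (u @ v) k = (if k < r + int (length u) then segment n r u k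
     else segment n (r + int (length u)) v k)"
proof -
  have "nat (k - (r + int (length u))) = nat (k - r) - length u" by simp
  then show ?thesis by (auto simp: segment_def nth_append)
qed

lemma segment_Cons:
  "segment n r (x # v) k = (if k = r then x else segment n (r + 1) v k)"
proof -
  have "nat (k - (r + 1)) = nat (k - r) - 1" by simp
  then show ?thesis by (auto simp: segment_def nth_Cons')
qed

lemma segment_outside: "k < r \<or> r + int (length d) \<le> k \<Longrightarrow> segment n r d k = n + 1"
  by (auto simp: segment_def)

lemma segment_in_set: "r \<le> k \<Longrightarrow> k < r + int (length d) \<Longrightarrow> segment n r d k \<in> set d"
  by (auto simp: segment_def)

lemma segment_ball_config:
  assumes "w \<in> permutations_of_set {1..n}"
  shows "ball_config n (segment n r w)"
  unfolding ball_config_def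
proof (intro conjI allI ballI)
  have w: "distinct w" "set w = {1..n}" using assms by (auto dest: permutations_of_setD)
  show "segment n r w k \<in> {1..n+1}" for k
    using w segment_in_set[of r k w n] segment_outside[of k r w n]
    by (cases "r \<le> k \<and> k < r + int (length w)") auto
  fix i assume i: "i \<in> {1..n}"
  then obtain m where m: "m < length w" "w ! m = i" using w by (metis in_set_conv_nth)
  show "\<exists>!k. segment n r w k = i"
  proof (rule ex1I)
    show "segment n r w (r + int m) = i" using m by (simp add: segment_def)
    fix k assume k: "segment n r w k = i"
    then have inb: "r \<le> k" "k < r + int (length w)" using i by (auto simp: segment_def split: if_splits)
    then have "w ! nat (k - r) = w ! m" using k m by (simp add: segment_def)
    moreover have "nat (k - r) < length w" using inb by simp
    ultimately have "nat (k - r) = m" using nth_eq_iff_index_eq[OF w(1)] m(1) by blast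
    then show "k = r + int m" using inb by simp
  qed
qed

text \<open>One ball \<open>x\<close>, a pair \<open>y, z\<close> in adjacent boxes, and the block \<open>d\<close>. All configurations from
  the first move on have this form, both before the collision, when the pair is the leftmost block,
  and after it, when the single ball is.\<close>

definition triple_config ::
    "nat \<Rightarrow> int \<Rightarrow> nat \<Rightarrow> int \<Rightarrow> nat \<Rightarrow> nat \<Rightarrow> int \<Rightarrow> nat list \<Rightarrow> config" where
  "triple_config n p x q y z r d = (segment n r d)(p := x, q := y, q + 1 := z)"

lemma triple_ball_config:
  assumes perm: "x # y # z # d \<in> permutations_of_set {1..n}"
    and pos: "p < r" "q + 1 < r" "p \<noteq> q" "p \<noteq> q + 1"
  shows "ball_config n (triple_config n p x q y z r d)" (is "ball_config n ?X")
  unfolding ball_config_def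
proof (intro conjI allI ballI)
  have balls: "set (x # y # z # d) = {1..n}" and w: "distinct (x # y # z # d)"
    using permutations_of_setD[OF perm] by blast+
  have mem: "x \<in> {1..n}" "y \<in> {1..n}" "z \<in> {1..n}" "\<And>i. i \<in> set d \<Longrightarrow> i \<in> {1..n}"
    unfolding balls[symmetric] by simp_all
  have d: "segment n r d k = n + 1 \<or> (r \<le> k \<and> segment n r d k \<in> set d)" for k
    by (simp add: segment_def) auto
  show "?X k \<in> {1..n+1}" for k
    using mem d[of k] by (auto simp: triple_config_def intro: le_SucI)
  fix i assume i: "i \<in> {1..n}"
  have inj: "k = l" if "segment n r d k = i" "segment n r d l = i" for k l
  proof -
    have "nat (k - r) = nat (l - r)" "r \<le> k" "r \<le> l"
      using that i w by (auto simp: segment_def nth_eq_iff_index_eq split: if_splits)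
    then show ?thesis by simp
  qed
  have ex: "\<exists>k\<ge>r. segment n r d k = i" if "i \<in> set d"
  proof -
    obtain m where "m < length d" "d ! m = i" using \<open>i \<in> set d\<close> by (metis in_set_conv_nth)
    then show ?thesis by (intro exI[of _ "r + int m"]) (simp add: segment_def)
  qed
  have X: "?X k = (if k = q + 1 then z else if k = q then y else if k = p then x else segment n r d k)" for k
    by (simp add: triple_config_def)
  have nd: "segment n r d k \<noteq> i" if "i \<notin> set d" for k
    using d[of k] i that by auto
  consider "i = x" | "i = y" | "i = z" | "i \<in> set d"
    using i unfolding balls[symmetric] by auto
  then show "\<exists>!k. ?X k = i"
  proof cases
    case 1 then show ?thesis using w nd pos by (intro ex1I[of _ p]) (auto simp: X split: if_splits)
  next
    case 2 then show ?thesis using w nd pos by (intro ex1I[of _ q]) (auto simp: X split: if_splits)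
  next
    case 3 then show ?thesis using w nd pos by (intro ex1I[of _ "q + 1"]) (auto simp: X split: if_splits)
  next
    case 4
    then obtain k where k: "r \<le> k" "segment n r d k = i" using ex by blast
    show ?thesis
    proof (rule ex1I[of _ k])
      show "?X k = i" using k pos by (simp add: X)
      show "l = k" if "?X l = i" for l
        using that 4 w inj[OF _ k(2)] by (auto simp: X split: if_splits)
    qed
  qed
qed

lemma permutations_of_set_cong:
  assumes "set u = set v" "distinct u \<longleftrightarrow> distinct v"
  shows "u \<in> permutations_of_set A \<longleftrightarrow> v \<in> permutations_of_set A"
  using assms by (simp add: permutations_of_set_def)

lemma permutations_of_set_bounds:
  assumes "x # y # z # d \<in> permutations_of_set {1..n}"
  shows "x \<le> n" "y \<le> n" "z \<le> n"
proof -
  have "set (x # y # z # d) = {1..n}" using permutations_of_setD[OF assms] by blast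
  then have "x \<in> {1..n}" "y \<in> {1..n}" "z \<in> {1..n}" by (metis list.set_intros)+
  then show "x \<le> n" "y \<le> n" "z \<le> n" by simp_all
qed

section \<open>Free motion and collision of three blocks\<close>

text \<open>The form in which standardness is used: the column conditions are exactly what the balls of
  the left blocks need in order to be allowed to jump into boxes that a right block vacates.\<close>

lemma standard_tableau_3_iff:
  assumes "length d = n - 3" "3 \<le> n"
  shows "standard_tableau [d, [y, z], [x]] \<longleftrightarrow>
     2 \<le> length d \<and> x # y # z # d \<in> permutations_of_set {1..n} \<and> sorted_wrt (<) d \<and>
     d ! 0 < y \<and> d ! 1 < z \<and> y < z \<and> y < x"
proof -
  have n: "length d + 3 = n" using assms by simp
  have perm: "d @ [y, z, x] \<in> permutations_of_set {1..n} \<longleftrightarrow> x # y # z # d \<in> permutations_of_set {1..n}"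
    by (rule permutations_of_set_cong) auto
  have cols: "(\<forall>i j. Suc i < length [d, [y, z], [x]] \<and> j < length ([d, [y, z], [x]] ! Suc i)
      \<longrightarrow> [d, [y, z], [x]] ! i ! j < [d, [y, z], [x]] ! Suc i ! j) \<longleftrightarrow>
      d ! 0 < y \<and> d ! 1 < z \<and> y < x" (is "?L \<longleftrightarrow> ?R")
  proof
    assume L: ?L
    show ?R using L[rule_format, of 0 0] L[rule_format, of 0 1] L[rule_format, of 1 0] by simp
  next
    assume ?R
    then show ?L by (auto simp: less_Suc_eq)
  qed
  have cells: "concat [d, [y, z], [x]] = d @ [y, z, x]" "length (d @ [y, z, x]) = n"
    using n by simp_all
  show ?thesis
    unfolding standard_tableau_def cols cells perm by auto
qed

lemma jump_okI:
  assumes "X p = i" "Y q = i" "p < q" "X q = n + 1 \<or> X q < i"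
    and "\<And>r. p < r \<Longrightarrow> r < q \<Longrightarrow> (i < X r \<and> X r \<le> n) \<or> Y r < i"
  shows "jump_ok n X Y i"
  unfolding jump_ok_def using assms by blast

lemma jump_ok_1:
  assumes "X p = i" "Y (p + 1) = i" "X (p + 1) = n + 1 \<or> X (p + 1) < i"
  shows "jump_ok n X Y i"
  by (rule jump_okI[of _ p _ _ "p + 1"]) (use assms in auto)

lemma jump_ok_2:
  assumes "X p = i" "Y (p + 2) = i" "X (p + 2) = n + 1 \<or> X (p + 2) < i"
    and "(i < X (p + 1) \<and> X (p + 1) \<le> n) \<or> Y (p + 1) < i"
  shows "jump_ok n X Y i"
proof (rule jump_okI[of _ p _ _ "p + 2"])
  fix r assume "p < r" "r < p + 2"
  then have "r = p + 1" by simp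
  then show "(i < X r \<and> X r \<le> n) \<or> Y r < i" using assms by simp
qed (use assms in auto)

lemma jump_ok_3:
  assumes "X p = i" "Y (p + 3) = i" "X (p + 3) = n + 1 \<or> X (p + 3) < i"
    and "(i < X (p + 1) \<and> X (p + 1) \<le> n) \<or> Y (p + 1) < i"
    and "(i < X (p + 2) \<and> X (p + 2) \<le> n) \<or> Y (p + 2) < i"
  shows "jump_ok n X Y i"
proof (rule jump_okI[of _ p _ _ "p + 3"])
  fix r assume "p < r" "r < p + 3"
  then consider "r = p + 1" | "r = p + 2" by linarith
  then show "(i < X r \<and> X r \<le> n) \<or> Y r < i" using assms by cases simp_all
qed (use assms in auto)

lemma segment_le_first:
  assumes "k \<le> r" "d ! 0 < v" shows "segment n r d k = n + 1 \<or> segment n r d k < v"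
  using assms by (auto simp: segment_def)

lemma segment_le_second:
  assumes "k \<le> r + 1" "d ! 1 < v" "sorted_wrt (<) d" "2 \<le> length d"
  shows "segment n r d k = n + 1 \<or> segment n r d k < v"
proof (cases "k \<le> r")
  case True
  have "d ! 0 < d ! 1" using assms by (auto intro: sorted_wrt_nth_less)
  then show ?thesis using segment_le_first[OF True] assms by (meson less_trans)
next
  case False
  then have "k = r + 1" using assms by simp
  then show ?thesis using assms by (auto simp: segment_def)
qed

text \<open>In an increasing block with nothing to its right, each ball jumps past the later balls of
  the block, which have not moved yet, and past the earlier ones, which have just landed, and so
  advances by the length of the block.\<close>

lemma segment_jump_ok:
  assumes srt: "sorted_wrt (<) d" and i: "i \<in> set d" and n: "set d \<subseteq> {1..n}"
    and X: "\<And>k. r \<le> k \<Longrightarrow> X k = segment n r d k"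
    and Y: "\<And>k. r + int (length d) \<le> k \<Longrightarrow> Y k = segment n (r + int (length d)) d k"
  shows "jump_ok n X Y i"
proof -
  obtain m where m: "m < length d" "d ! m = i" using i by (metis in_set_conv_nth)
  have "i < X k \<and> X k \<le> n \<or> Y k < i"
    if k: "r + int m < k" "k < r + int (length d) + int m" for k
  proof (cases "k < r + int (length d)")
    case True
    then have "X k = d ! nat (k - r)" "nat (k - r) < length d" "m < nat (k - r)"
      using X[of k] k by (auto simp: segment_def)
    then have "i < X k \<and> X k \<in> set d" using sorted_wrt_nth_less[OF srt] m by auto
    then show ?thesis using n by auto
  next
    case False
    then have "Y k = d ! nat (k - (r + int (length d)))" "nat (k - (r + int (length d))) < m"
      using Y[of k] k m by (auto simp: segment_def)
    then show ?thesis using sorted_wrt_nth_less[OF srt] m by auto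
  qed
  then show ?thesis
    using m X[of "r + int m"] X[of "r + int (length d) + int m"] Y[of "r + int (length d) + int m"]
    by (intro jump_okI[of _ "r + int m" _ _ "r + int (length d) + int m"])
      (auto simp: segment_def)
qed

lemma triple_config_segment:
  "p < r \<Longrightarrow> q + 1 < r \<Longrightarrow> r \<le> k \<Longrightarrow> triple_config n p x q y z r d k = segment n r d k"
  by (auto simp: triple_config_def)

text \<open>The block \<open>d\<close> always moves freely, so only the three other balls remain to be checked.\<close>

lemma triple_BB_eqI:
  fixes r :: int and d :: "nat list"
  defines "r' \<equiv> r + int (length d)"
  assumes perm: "x # y # z # d \<in> permutations_of_set {1..n}"
    and perm': "x' # y' # z' # d \<in> permutations_of_set {1..n}"
    and srt: "sorted_wrt (<) d"
    and pos: "p < r" "q + 1 < r" "p \<noteq> q" "p \<noteq> q + 1"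
    and pos': "p' < r'" "q' + 1 < r'" "p' \<noteq> q'" "p' \<noteq> q' + 1"
    and ok: "\<And>i. i \<in> {x, y, z} \<Longrightarrow>
       jump_ok n (triple_config n p x q y z r d) (triple_config n p' x' q' y' z' r' d) i"
  shows "BB n (triple_config n p x q y z r d) = triple_config n p' x' q' y' z' r' d"
proof (rule BB_eqI)
  show "ball_config n (triple_config n p x q y z r d)" by (rule triple_ball_config[OF perm pos])
  show "ball_config n (triple_config n p' x' q' y' z' r' d)" by (rule triple_ball_config[OF perm' pos'])
  fix i assume i: "i \<in> {1..n}"
  have balls: "set (x # y # z # d) = {1..n}" using permutations_of_setD[OF perm] by blast
  consider "i \<in> {x, y, z}" | "i \<in> set d" using i unfolding balls[symmetric] by auto
  then show "jump_ok n (triple_config n p x q y z r d) (triple_config n p' x' q' y' z' r' d) i"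
  proof cases
    case 2
    show ?thesis
    proof (rule segment_jump_ok[OF srt 2])
      show "set d \<subseteq> {1..n}" unfolding balls[symmetric] by auto
      show "triple_config n p x q y z r d k = segment n r d k" if "r \<le> k" for k
        using pos that by (intro triple_config_segment)
      show "triple_config n p' x' q' y' z' r' d k = segment n (r + int (length d)) d k"
        if "r + int (length d) \<le> k" for k
        using pos' that unfolding r'_def by (intro triple_config_segment)
    qed
  qed (use ok in blast)
qed

text \<open>The smallest block being leftmost, the blocks move at speeds 1, 2 and \<open>n - 3\<close> and never meet
  again. They may be adjacent at the start, and then the column conditions
  \<open>y < x\<close>, \<open>d ! 0 < y\<close> and \<open>d ! 1 < z\<close> guarantee that the boxes ahead have been left in time.\<close>

lemma BB_standard:
  assumes std: "standard_tableau [d, [y, z], [x]]" and n: "length d = n - 3" "3 \<le> n"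
    and pos: "p < q" "q + 1 < r"
  shows "BB n (triple_config n p x q y z r d) =
    triple_config n (p + 1) x (q + 2) y z (r + int (length d)) d"
proof -
  have T: "2 \<le> length d" "x # y # z # d \<in> permutations_of_set {1..n}" "sorted_wrt (<) d"
     "d ! 0 < y" "d ! 1 < z" "y < z" "y < x"
    using std unfolding standard_tableau_3_iff[OF n] by auto
  have le: "x \<le> n" "y \<le> n" "z \<le> n" using permutations_of_set_bounds[OF T(2)] .
  have seg: "segment n r d (p + 1) = n + 1" "segment n r d (q + 2) = n + 1 \<or> segment n r d (q + 2) < y"
    "segment n r d (q + 3) = n + 1 \<or> segment n r d (q + 3) < z"
    using T pos segment_outside segment_le_first segment_le_second by auto
  have "jump_ok n (triple_config n p x q y z r d)
       (triple_config n (p + 1) x (q + 2) y z (r + int (length d)) d) i" if i: "i \<in> {x, y, z}" for i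
  proof -
    consider "i = x" | "i = y" | "i = z" using i by auto
    then show ?thesis
    proof cases
      case 1
      show ?thesis by (rule jump_ok_1[of _ p])
          (use T seg pos le 1 in \<open>auto simp: triple_config_def ac_simps\<close>)
    next
      case 2
      show ?thesis by (rule jump_ok_2[of _ q])
          (use T seg pos le 2 in \<open>auto simp: triple_config_def ac_simps\<close>)
    next
      case 3
      show ?thesis by (rule jump_ok_2[of _ "q + 1"])
          (use T seg pos le 3 in \<open>auto simp: triple_config_def ac_simps\<close>)
    qed
  qed
  then show ?thesis
    by (intro triple_BB_eqI[OF T(2) T(2) T(3)]) (use pos T(1) in auto)
qed

text \<open>The pair is behind the single ball \<open>c\<close> and gains one box on it in each move. If only one free
  box separates \<open>b\<close> from \<open>c\<close>, then \<open>b\<close> lands in the box of \<open>c\<close>, which is empty by then because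
  of \<open>c < b\<close>.\<close>

lemma BB_approach:
  assumes perm: "c # a # b # d \<in> permutations_of_set {1..n}" and srt: "sorted_wrt (<) d" "2 \<le> length d"
    and ord: "d ! 0 < c" "a < b" "c < b"
    and pos: "q + 3 \<le> p" "p < r"
  shows "BB n (triple_config n p c q a b r d) =
    triple_config n (p + 1) c (q + 2) a b (r + int (length d)) d"
proof -
  have le: "c \<le> n" "a \<le> n" "b \<le> n" using permutations_of_set_bounds[OF perm] .
  have seg: "segment n r d (p + 1) = n + 1 \<or> segment n r d (p + 1) < c"
    "segment n r d (q + 2) = n + 1" "segment n r d (q + 3) = n + 1"
    using ord pos segment_outside segment_le_first by auto
  have "jump_ok n (triple_config n p c q a b r d)
       (triple_config n (p + 1) c (q + 2) a b (r + int (length d)) d) i" if i: "i \<in> {c, a, b}" for i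
  proof -
    consider "i = c" | "i = a" | "i = b" using i by auto
    then show ?thesis
    proof cases
      case 1
      show ?thesis by (rule jump_ok_1[of _ p])
          (use seg pos le ord 1 in \<open>auto simp: triple_config_def ac_simps\<close>)
    next
      case 2
      show ?thesis by (rule jump_ok_2[of _ q])
          (use seg pos le ord 2 in \<open>auto simp: triple_config_def ac_simps\<close>)
    next
      case 3
      show ?thesis by (rule jump_ok_2[of _ "q + 1"])
          (use seg pos le ord 3 in \<open>auto simp: triple_config_def ac_simps\<close>)
    qed
  qed
  then show ?thesis
    by (intro triple_BB_eqI[OF perm perm srt(1)]) (use pos srt(2) in auto)
qed

text \<open>A collision acts as row insertion of \<open>c\<close> into the row \<open>[a, b]\<close>: for \<open>c < a\<close> the ball \<open>a\<close> is
  bumped, that is, it only gets to the box that \<open>c\<close> has just left and stays behind as the new single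
  ball, while \<open>b\<close> jumps over both and joins \<open>c\<close>.\<close>

lemma BB_collision_small:
  assumes std: "standard_tableau [d, [c, b], [a]]" and n: "length d = n - 3" "3 \<le> n"
    and ord: "a < b" and pos: "q + 2 < r"
  shows "BB n (triple_config n (q + 2) c q a b r d) =
    triple_config n (q + 2) a (q + 3) c b (r + int (length d)) d"
proof -
  have T: "2 \<le> length d" "a # c # b # d \<in> permutations_of_set {1..n}" "sorted_wrt (<) d"
     "d ! 0 < c" "d ! 1 < b" "c < b" "c < a"
    using std unfolding standard_tableau_3_iff[OF n] by auto
  have perm: "c # a # b # d \<in> permutations_of_set {1..n}" using T(2)
    by (rule permutations_of_set_cong[THEN iffD1, rotated 2]) auto
  have le: "c \<le> n" "a \<le> n" "b \<le> n" using permutations_of_set_bounds[OF perm] .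
  have seg: "segment n r d (q + 3) = n + 1 \<or> segment n r d (q + 3) < c"
    "segment n r d (q + 4) = n + 1 \<or> segment n r d (q + 4) < b"
    using T pos segment_le_first segment_le_second by auto
  have "jump_ok n (triple_config n (q + 2) c q a b r d)
       (triple_config n (q + 2) a (q + 3) c b (r + int (length d)) d) i" if i: "i \<in> {c, a, b}" for i
  proof -
    consider "i = c" | "i = a" | "i = b" using i by auto
    then show ?thesis
    proof cases
      case 1
      show ?thesis by (rule jump_ok_1[of _ "q + 2"])
          (use seg pos le ord T 1 in \<open>auto simp: triple_config_def ac_simps\<close>)
    next
      case 2
      show ?thesis by (rule jump_ok_2[of _ q])
          (use seg pos le ord T 2 in \<open>auto simp: triple_config_def ac_simps\<close>)
    next
      case 3
      show ?thesis by (rule jump_ok_3[of _ "q + 1"])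
          (use seg pos le ord T 3 in \<open>auto simp: triple_config_def ac_simps\<close>)
    qed
  qed
  then show ?thesis
    by (intro triple_BB_eqI[OF perm T(2,3)]) (use pos T(1) in auto)
qed

text \<open>For \<open>a < c < b\<close> the ball \<open>a\<close> jumps first, over \<open>b\<close> and \<open>c\<close>, and it is \<open>b\<close> that only gets to the
  box left by \<open>c\<close>.\<close>

lemma BB_collision_medium:
  assumes std: "standard_tableau [d, [a, c], [b]]" and n: "length d = n - 3" "3 \<le> n"
    and ord: "c < b" and pos: "q + 2 < r"
  shows "BB n (triple_config n (q + 2) c q a b r d) =
    triple_config n (q + 2) b (q + 3) a c (r + int (length d)) d"
proof -
  have T: "2 \<le> length d" "b # a # c # d \<in> permutations_of_set {1..n}" "sorted_wrt (<) d"
     "d ! 0 < a" "d ! 1 < c" "a < c" "a < b"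
    using std unfolding standard_tableau_3_iff[OF n] by auto
  have perm: "c # a # b # d \<in> permutations_of_set {1..n}" using T(2)
    by (rule permutations_of_set_cong[THEN iffD1, rotated 2]) auto
  have le: "c \<le> n" "a \<le> n" "b \<le> n" using permutations_of_set_bounds[OF perm] .
  have seg: "segment n r d (q + 3) = n + 1 \<or> segment n r d (q + 3) < a"
    "segment n r d (q + 4) = n + 1 \<or> segment n r d (q + 4) < c"
    using T pos segment_le_first segment_le_second by auto
  have "jump_ok n (triple_config n (q + 2) c q a b r d)
       (triple_config n (q + 2) b (q + 3) a c (r + int (length d)) d) i" if i: "i \<in> {c, a, b}" for i
  proof -
    consider "i = c" | "i = a" | "i = b" using i by auto
    then show ?thesis
    proof cases
      case 1
      show ?thesis by (rule jump_ok_2[of _ "q + 2"])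
          (use seg pos le ord T 1 in \<open>auto simp: triple_config_def ac_simps\<close>)
    next
      case 2
      show ?thesis by (rule jump_ok_3[of _ q])
          (use seg pos le ord T 2 in \<open>auto simp: triple_config_def ac_simps\<close>)
    next
      case 3
      show ?thesis by (rule jump_ok_1[of _ "q + 1"])
          (use seg pos le ord T 3 in \<open>auto simp: triple_config_def ac_simps\<close>)
    qed
  qed
  then show ?thesis
    by (intro triple_BB_eqI[OF perm T(2,3)]) (use pos T(1) in auto)
qed

section \<open>Runs, solitons and the steady state\<close>

lemma increasing_at_less:
  assumes "increasing_at n X a b" "a \<le> u" "u < v" "v \<le> b"
  shows "X u < X v"
proof -
  have "strict_mono_on {a..b} X" "u \<in> {a..b}" "v \<in> {a..b}"
    using assms unfolding increasing_at_def by auto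
  then show ?thesis using assms(3) by (rule strict_mono_onD)
qed

lemma increasing_at_right:
  assumes "increasing_at n X a b" "a \<le> h" "X (h + 1) = n + 1 \<or> X (h + 1) \<le> X h"
  shows "b \<le> h"
proof (rule ccontr)
  assume "\<not> b \<le> h"
  then have "X h < X (h + 1)" using increasing_at_less[OF assms(1), of h "h + 1"] assms(2) by simp
  moreover have "X (h + 1) \<le> n" using assms(1,2) \<open>\<not> b \<le> h\<close> unfolding increasing_at_def by auto
  ultimately show False using assms(3) by auto
qed

lemma increasing_at_left:
  assumes "increasing_at n X a b" "l \<le> b" "X l \<le> X (l - 1)"
  shows "l \<le> a"
proof (rule ccontr)
  assume "\<not> l \<le> a"
  then have "X (l - 1) < X l" using increasing_at_less[OF assms(1), of "l - 1" l] assms(2) by simp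
  then show False using assms(3) by auto
qed

lemma run_atI:
  assumes "increasing_at n X l h" "X l \<le> X (l - 1)" "X (h + 1) = n + 1 \<or> X (h + 1) \<le> X h"
  shows "run_at n X l h"
  unfolding run_at_def
proof (intro conjI allI impI)
  fix a b assume ab: "increasing_at n X a b \<and> {l..h} \<subseteq> {a..b}"
  have "l \<le> h" using assms(1) by (simp add: increasing_at_def)
  then have "a \<le> l" "h \<le> b" using ab by auto
  moreover have "l \<le> a" using increasing_at_left[of n X a b l] ab assms \<open>l \<le> h\<close> \<open>h \<le> b\<close> by auto
  moreover have "b \<le> h" using increasing_at_right[of n X a b h] ab assms \<open>l \<le> h\<close> \<open>a \<le> l\<close> by auto
  ultimately show "a = l" "b = h" by auto
qed (use assms in auto)

lemma run_at_unique:
  assumes lh: "increasing_at n X l h" "X l \<le> X (l - 1)" "X (h + 1) = n + 1 \<or> X (h + 1) \<le> X h"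
    and ab: "run_at n X a b" and a: "l \<le> a" "a \<le> h"
  shows "a = l \<and> b = h"
proof -
  have inc: "increasing_at n X a b" using ab unfolding run_at_def by blast
  have "b \<le> h" using increasing_at_right[OF inc a(2) lh(3)] .
  moreover have "a \<le> b" using inc by (simp add: increasing_at_def)
  ultimately have "{a..b} \<subseteq> {l..h}" using a by auto
  then show ?thesis using ab lh(1) unfolding run_at_def by blast
qed

text \<open>Between adjacent blocks there is a descent, again by the column conditions, so the runs are
  the three blocks.\<close>

lemma triple_runs:
  assumes std: "standard_tableau [d, [y, z], [x]]" and n: "length d = n - 3" "3 \<le> n"
    and pos: "p < q" "q + 1 < r"
  shows "run_at n (triple_config n p x q y z r d) a b \<longleftrightarrow>
    (a, b) \<in> {(p, p), (q, q + 1), (r, r + int (length d) - 1)}" (is "run_at n ?X a b \<longleftrightarrow> _")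
proof -
  have T: "2 \<le> length d" "x # y # z # d \<in> permutations_of_set {1..n}" "sorted_wrt (<) d"
     "d ! 0 < y" "d ! 1 < z" "y < z" "y < x"
    using std unfolding standard_tableau_3_iff[OF n] by auto
  have balls: "set (x # y # z # d) = {1..n}" using permutations_of_setD[OF T(2)] by blast
  have mem: "x \<in> {1..n}" "y \<in> {1..n}" "z \<in> {1..n}" "\<And>i. i \<in> set d \<Longrightarrow> i \<in> {1..n}"
    unfolding balls[symmetric] by simp_all
  have X: "?X k = (if k = q + 1 then z else if k = q then y else if k = p then x else segment n r d k)" for k
    by (simp add: triple_config_def)
  have out: "segment n r d k = n + 1" if "k < r \<or> r + int (length d) \<le> k" for k
    using segment_outside that by simp
  have first: "segment n r d k = n + 1 \<or> segment n r d k < y" if "k \<le> r" for k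
    using segment_le_first[OF that T(4)] .
  have p: "increasing_at n ?X p p" "?X p \<le> ?X (p - 1)" "?X (p + 1) = n + 1 \<or> ?X (p + 1) \<le> ?X p"
    using mem pos T out by (auto simp: increasing_at_def X strict_mono_on_def)
  have q: "increasing_at n ?X q (q + 1)" "?X q \<le> ?X (q - 1)"
    "?X (q + 1 + 1) = n + 1 \<or> ?X (q + 1 + 1) \<le> ?X (q + 1)"
  proof -
    show "increasing_at n ?X q (q + 1)"
      using mem pos T by (auto simp: increasing_at_def X strict_mono_on_def)
    show "?X q \<le> ?X (q - 1)" using mem pos T out by (auto simp: X)
    show "?X (q + 1 + 1) = n + 1 \<or> ?X (q + 1 + 1) \<le> ?X (q + 1)"
      using first[of "q + 1 + 1"] pos T by (auto simp: X)
  qed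
  have r: "increasing_at n ?X r (r + int (length d) - 1)" "?X r \<le> ?X (r - 1)"
    "?X (r + int (length d) - 1 + 1) = n + 1 \<or>
     ?X (r + int (length d) - 1 + 1) \<le> ?X (r + int (length d) - 1)"
  proof -
    have "d \<noteq> []" using T(1) by (cases d) auto
    have "\<forall>k\<in>{r..r + int (length d) - 1}. ?X k = d ! nat (k - r) \<and> nat (k - r) < length d"
      using pos by (auto simp: X segment_def)
    moreover from this have "strict_mono_on {r..r + int (length d) - 1} ?X"
      using sorted_wrt_nth_less[OF T(3)] by (auto simp: strict_mono_on_def)
    ultimately show "increasing_at n ?X r (r + int (length d) - 1)"
      using mem \<open>d \<noteq> []\<close> unfolding increasing_at_def by (auto simp del: One_nat_def)
    have "d ! 0 \<in> set d" using \<open>d \<noteq> []\<close> by (intro nth_mem) simp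
    then have "d ! 0 \<le> n" using mem(4) by auto
    then have "?X r \<le> n" "?X r = d ! 0" using T(1) pos by (auto simp: X segment_def)
    then show "?X r \<le> ?X (r - 1)" using T pos out[of "r - 1"] by (auto simp: X)
    show "?X (r + int (length d) - 1 + 1) = n + 1 \<or>
     ?X (r + int (length d) - 1 + 1) \<le> ?X (r + int (length d) - 1)"
      using pos out by (auto simp: X)
  qed
  show ?thesis
  proof
    assume ab: "run_at n ?X a b"
    then have "increasing_at n ?X a b" unfolding run_at_def by blast
    then have "?X a \<noteq> n + 1" unfolding increasing_at_def by force
    then consider "p \<le> a" "a \<le> p" | "q \<le> a" "a \<le> q + 1" | "r \<le> a" "a \<le> r + int (length d) - 1"
      using out[of a] by (fastforce simp: X split: if_splits)
    then show "(a, b) \<in> {(p, p), (q, q + 1), (r, r + int (length d) - 1)}"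
      using run_at_unique[OF p ab] run_at_unique[OF q ab] run_at_unique[OF r ab] by cases auto
  next
    assume "(a, b) \<in> {(p, p), (q, q + 1), (r, r + int (length d) - 1)}"
    then show "run_at n ?X a b" using run_atI[OF p] run_atI[OF q] run_atI[OF r] by auto
  qed
qed

lemma map_triple:
  assumes pos: "p < q" "q + 1 < r"
  shows "map (triple_config n p x q y z r d) [p..p] = [x]"
    and "map (triple_config n p x q y z r d) [q..q + 1] = [y, z]"
    and "map (triple_config n p x q y z r d) [r..r + int (length d) - 1] = d"
proof -
  show "map (triple_config n p x q y z r d) [p..p] = [x]"
    using pos by (simp add: triple_config_def)
  have "[q..q + 1] = [q, q + 1]" by (simp add: upto.simps)
  then show "map (triple_config n p x q y z r d) [q..q + 1] = [y, z]"
    by (simp add: triple_config_def)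
  show "map (triple_config n p x q y z r d) [r..r + int (length d) - 1] = d"
    using pos by (intro nth_equalityI) (auto simp: triple_config_def segment_def)
qed

lemma BB_iterate_standard:
  assumes std: "standard_tableau [d, [y, z], [x]]" and n: "length d = n - 3" "3 \<le> n"
    and pos: "p < q" "q + 1 < r"
  shows "\<exists>p' q' r'. p' < q' \<and> q' + 1 < r' \<and>
    (BB n ^^ t) (triple_config n p x q y z r d) = triple_config n p' x q' y z r' d"
proof (induction t)
  case 0
  show ?case using pos by auto
next
  case (Suc t)
  then obtain p' q' r' where IH: "p' < q'" "q' + 1 < r'"
    "(BB n ^^ t) (triple_config n p x q y z r d) = triple_config n p' x q' y z r' d" by blast
  have "2 \<le> length d" using std unfolding standard_tableau_3_iff[OF n] by auto
  then have "p' + 1 < q' + 2" "q' + 2 + 1 < r' + int (length d)" using IH by auto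
  moreover have "(BB n ^^ Suc t) (triple_config n p x q y z r d) =
      triple_config n (p' + 1) x (q' + 2) y z (r' + int (length d)) d"
    using IH(3) BB_standard[OF std n IH(1,2)] by simp
  ultimately show ?case by blast
qed

lemma standard_solitons:
  assumes std: "standard_tableau [d, [y, z], [x]]" and n: "length d = n - 3" "3 \<le> n"
    and pos: "p < q" "q + 1 < r" and s: "s \<in> {[x], [y, z], d}"
  shows "soliton n (triple_config n p x q y z r d) s"
  unfolding soliton_def
proof
  fix t
  obtain p' q' r' where IH: "p' < q'" "q' + 1 < r'"
    "(BB n ^^ t) (triple_config n p x q y z r d) = triple_config n p' x q' y z r' d"
    using BB_iterate_standard[OF std n pos] by blast
  have run: "increasing_run n (triple_config n p' x q' y z r' d)
      (map (triple_config n p' x q' y z r' d) [a..b])"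
    if "(a, b) \<in> {(p', p'), (q', q' + 1), (r', r' + int (length d) - 1)}" for a b
    using triple_runs[OF std n IH(1,2)] that unfolding increasing_run_def by blast
  have "increasing_run n (triple_config n p' x q' y z r' d) s"
    using s run[of p' p'] run[of q' "q' + 1"] run[of r' "r' + int (length d) - 1"]
    unfolding map_triple[OF IH(1,2)] by blast
  then show "increasing_run n ((BB n ^^ t) (triple_config n p x q y z r d)) s" using IH(3) by simp
qed

lemma standard_steady_state:
  assumes std: "standard_tableau [d, [y, z], [x]]" and n: "length d = n - 3" "3 \<le> n"
    and pos: "p < q" "q + 1 < r"
  shows "steady_state n (triple_config n p x q y z r d)"
proof -
  have "x # y # z # d \<in> permutations_of_set {1..n}"
    using std unfolding standard_tableau_3_iff[OF n] by auto
  then have balls: "set (x # y # z # d) = {1..n}" by (rule permutations_of_setD)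
  have "\<exists>s\<in>{[x], [y, z], d}. i \<in> set s" if "i \<in> set (x # y # z # d)" for i
    using that by auto
  then show ?thesis unfolding steady_state_def balls[symmetric]
    using standard_solitons[OF std n pos] by blast
qed

lemma solitons_right_to_left_standard:
  assumes std: "standard_tableau [d, [y, z], [x]]" and n: "length d = n - 3" "3 \<le> n"
    and pos: "p < q" "q + 1 < r"
  shows "solitons_right_to_left n (triple_config n p x q y z r d) = [d, [y, z], [x]]"
proof -
  let ?X = "triple_config n p x q y z r d"
  let ?l = "[(p, p), (q, q + 1), (r, r + int (length d) - 1)]"
  have "{(a, b). run_at n ?X a b \<and> soliton n ?X (map ?X [a..b])} = set ?l"
    using triple_runs[OF std n pos] map_triple[OF pos, of n x y z d]
      standard_solitons[OF std n pos] by auto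
  moreover have "sorted_key_list_of_set fst (set ?l) = ?l"
  proof -
    interpret folding_on "set ?l" "insort_key fst" "[] :: (int \<times> int) list"
    proof
      fix u v assume uv: "u \<in> set ?l" "v \<in> set ?l"
      then have "u = v \<or> fst u \<noteq> fst v" using pos by force
      then show "insort_key fst v \<circ> insort_key fst u = insort_key fst u \<circ> insort_key fst v"
      proof
        assume "fst u \<noteq> fst v"
        then show ?thesis by (intro ext) (metis insort_key_left_comm o_apply)
      qed simp
    qed
    show ?thesis unfolding sorted_key_list_of_set_def using pos by simp
  qed
  ultimately show ?thesis
    using map_triple[OF pos, of n x y z d] by (simp add: solitons_right_to_left_def)
qed

lemma steady_state_funpow:
  assumes "steady_state n X" shows "steady_state n ((BB n ^^ t) X)"
proof -
  have "soliton n ((BB n ^^ t) X) s" if "soliton n X s" for s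
    using that unfolding soliton_def by (metis funpow_add o_apply)
  then show ?thesis using assms unfolding steady_state_def by blast
qed

lemma run_at_extends_left:
  assumes run: "run_at n X l h" and k: "k + 1 \<in> {l..h}" and less: "1 \<le> X k" "X k < X (k + 1)"
  shows "k \<in> {l..h}"
proof (rule ccontr)
  assume "k \<notin> {l..h}"
  then have l: "l = k + 1" using k by auto
  have inc: "increasing_at n X l h" using run unfolding run_at_def by blast
  \<comment> \<open>Otherwise the run could be extended by box \<open>k\<close>.\<close>
  have "increasing_at n X k h"
    unfolding increasing_at_def
  proof (intro conjI ballI)
    show "k \<le> h" using k by auto
    show "X m \<in> {1..n}" if "m \<in> {k..h}" for m
    proof (cases "m = k")
      case True
      have "X (k + 1) \<le> n" using inc k unfolding increasing_at_def by auto
      then show ?thesis using less True by simp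
    next
      case False
      then show ?thesis using inc l that unfolding increasing_at_def by auto
    qed
    show "strict_mono_on {k..h} X"
    proof (rule strict_mono_onI)
      fix u v assume uv: "u \<in> {k..h}" "v \<in> {k..h}" "u < v"
      have mono: "X u < X v" if "u \<in> {l..h}" "v \<in> {l..h}" "u < v" for u v
        using increasing_at_less[OF inc] that by simp
      show "X u < X v"
      proof (cases "u = k")
        case True
        show ?thesis
        proof (cases "v = k + 1")
          case False
          then have "X (k + 1) < X v" using uv True l by (intro mono) auto
          then show ?thesis using less True by simp
        qed (use less True in simp)
      qed (use uv l in \<open>auto intro: mono\<close>)
    qed
  qed
  moreover have "{l..h} \<subseteq> {k..h}" using l by auto
  ultimately have "k = l" using run unfolding run_at_def by blast
  then show False using l by simp
qed

text \<open>A soliton that contains the ball in box \<open>k + 1\<close> also contains the smaller ball directly to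
  its left, and must still contain both after the next move. This fails if the two balls have been
  put in the wrong order or have been separated by a descent.\<close>

lemma not_steady_stateI:
  assumes X: "ball_config n X" and k: "1 \<le> X k" "X k < X (k + 1)" "X (k + 1) \<le> n"
    and X': "ball_config n (BB n X)"
    and uv: "BB n X u = X k" "BB n X v = X (k + 1)"
    and sep: "v < u \<or> (\<exists>m. u \<le> m \<and> m < v \<and> BB n X (m + 1) \<le> BB n X m)"
  shows "\<not> steady_state n X"
proof
  assume "steady_state n X"
  moreover have i: "X k \<in> {1..n}" "X (k + 1) \<in> {1..n}" using k by auto
  ultimately obtain s where s: "soliton n X s" "X (k + 1) \<in> set s"
    unfolding steady_state_def by blast
  have "increasing_run n X s" using s(1) unfolding soliton_def by (metis funpow_0)
  then obtain l h where lh: "run_at n X l h" "s = map X [l..h]" unfolding increasing_run_def by blast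
  obtain m where "m \<in> {l..h}" "X m = X (k + 1)" using s(2) lh(2) by auto
  then have "k + 1 \<in> {l..h}" using X i(2) unfolding ball_config_def by metis
  then have "k \<in> {l..h}" using run_at_extends_left[OF lh(1) _ k(1,2)] by blast
  then have ks: "X k \<in> set s" using lh(2) by simp
  have "increasing_run n (BB n X) s"
    using s(1) unfolding soliton_def by (metis funpow_0 funpow.simps(2) o_apply)
  then obtain a b where ab: "increasing_at n (BB n X) a b" "s = map (BB n X) [a..b]"
    unfolding increasing_run_def run_at_def by blast
  obtain u' v' where "u' \<in> {a..b}" "BB n X u' = X k" "v' \<in> {a..b}" "BB n X v' = X (k + 1)"
    using ks s(2) ab(2) by auto
  then have in_ab: "u \<in> {a..b}" "v \<in> {a..b}"
    using X' i uv unfolding ball_config_def by metis+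
  have mono: "BB n X i < BB n X j" if "i \<in> {a..b}" "j \<in> {a..b}" "i < j" for i j
    using increasing_at_less[OF ab(1)] that by simp
  from sep show False
  proof
    assume "v < u"
    then show False using mono[OF in_ab(2,1)] uv k by simp
  next
    assume "\<exists>m. u \<le> m \<and> m < v \<and> BB n X (m + 1) \<le> BB n X m"
    then obtain m where m: "u \<le> m" "m < v" "BB n X (m + 1) \<le> BB n X m" by blast
    then show False using mono[of m "m + 1"] in_ab by simp
  qed
qed

text \<open>The blocks of a configuration of this shape are its solitons, so the soliton decomposition is
  the standard tableau with rows \<open>d\<close>, \<open>[y, z]\<close> and \<open>[x]\<close>; it only remains to know that the
  configuration one move earlier was not steady.\<close>

lemma steady_state_time_good:
  assumes w: "length w = n" "(BB n ^^ t) (config_of w) = triple_config n p x q y z r d"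
    and std: "standard_tableau [d, [y, z], [x]]" and n: "length d = n - 3" "3 \<le> n"
    and pos: "p < q" "q + 1 < r"
    and least: "t = 0 \<or> \<not> steady_state n ((BB n ^^ (t - 1)) (config_of w))"
  shows "steady_state_time w = t \<and> good_permutation w"
proof -
  have "steady_state_time w = t"
    unfolding steady_state_time_def w(1)
  proof (rule Least_equality)
    show "steady_state n ((BB n ^^ t) (config_of w))"
      unfolding w by (rule standard_steady_state[OF std n pos])
    fix s assume s: "steady_state n ((BB n ^^ s) (config_of w))"
    show "t \<le> s"
    proof (rule ccontr)
      assume "\<not> t \<le> s"
      then have "t \<noteq> 0" "t - 1 = (t - 1 - s) + s" by auto
      then show False using least steady_state_funpow[OF s, of "t - 1 - s"]
        by (metis funpow_add o_apply)
    qed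
  qed
  then show ?thesis
    using solitons_right_to_left_standard[OF std n pos] std
    by (simp add: good_permutation_def soliton_decomposition_def w)
qed

section \<open>A collision happens before the steady state\<close>

text \<open>The result of inserting \<open>c\<close> into the row \<open>[a, b]\<close> below the first row \<open>d\<close> is a standard
  tableau. The first alternative is the case \<open>c < a\<close>, the second one the case \<open>a < c\<close>.\<close>

definition colliding :: "nat list \<Rightarrow> nat \<Rightarrow> nat \<Rightarrow> nat \<Rightarrow> bool" where
  "colliding d a b c \<longleftrightarrow> a < b \<and> c < b \<and>
     (standard_tableau [d, [c, b], [a]] \<or> standard_tableau [d, [a, c], [b]])"

text \<open>The collision tears the balls \<open>a\<close> and \<open>b\<close> apart, which were adjacent before it, so the
  configuration before the collision is not steady.\<close>

lemma collision:
  assumes col: "colliding d a b c" and n: "length d = n - 3" "3 \<le> n" and pos: "q + 2 < r"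
  defines "X \<equiv> triple_config n (q + 2) c q a b r d"
  obtains x y z where "standard_tableau [d, [y, z], [x]]"
    and "BB n X = triple_config n (q + 2) x (q + 3) y z (r + int (length d)) d"
    and "\<not> steady_state n X"
proof -
  have ord: "a < b" "c < b" using col by (auto simp: colliding_def)
  consider (small) "standard_tableau [d, [c, b], [a]]" | (medium) "standard_tableau [d, [a, c], [b]]"
    using col unfolding colliding_def by blast
  then show thesis
  proof cases
    case small
    have T: "2 \<le> length d" "a # c # b # d \<in> permutations_of_set {1..n}" "c < a"
      using small unfolding standard_tableau_3_iff[OF n] by auto
    have perm: "c # a # b # d \<in> permutations_of_set {1..n}" using T(2)
      by (rule permutations_of_set_cong[THEN iffD1, rotated 2]) auto
    have step: "BB n X = triple_config n (q + 2) a (q + 3) c b (r + int (length d)) d"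
      unfolding X_def by (rule BB_collision_small[OF small n ord(1) pos])
    have "ball_config n X" unfolding X_def by (rule triple_ball_config[OF perm]) (use pos in auto)
    moreover have "ball_config n (BB n X)" unfolding step
      by (rule triple_ball_config[OF T(2)]) (use pos T(1) in auto)
    moreover have "1 \<le> X q" "X q < X (q + 1)" "X (q + 1) \<le> n"
      "BB n X (q + 2) = X q" "BB n X (q + 4) = X (q + 1)" "BB n X (q + 2 + 1) \<le> BB n X (q + 2)"
      unfolding step unfolding X_def
      using T(3) ord permutations_of_set_bounds[OF T(2)] by (auto simp: triple_config_def)
    ultimately have "\<not> steady_state n X"
      by (intro not_steady_stateI[of n X q "q + 2" "q + 4"] disjI2 exI[of _ "q + 2"]) auto
    with small step show thesis by (rule that)
  next
    case medium
    have T: "2 \<le> length d" "b # a # c # d \<in> permutations_of_set {1..n}" "a < c"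
      "d ! 0 < a"
      using medium unfolding standard_tableau_3_iff[OF n] by auto
    have perm: "c # a # b # d \<in> permutations_of_set {1..n}" using T(2)
      by (rule permutations_of_set_cong[THEN iffD1, rotated 2]) auto
    have step: "BB n X = triple_config n (q + 2) b (q + 3) a c (r + int (length d)) d"
      unfolding X_def by (rule BB_collision_medium[OF medium n ord(2) pos])
    have "ball_config n X" unfolding X_def by (rule triple_ball_config[OF perm]) (use pos in auto)
    moreover have "ball_config n (BB n X)" unfolding step
      by (rule triple_ball_config[OF T(2)]) (use pos T(1) in auto)
    moreover have "1 \<le> X q" "X q < X (q + 1)" "X (q + 1) \<le> n"
      "BB n X (q + 3) = X q" "BB n X (q + 2) = X (q + 1)"
      unfolding step unfolding X_def
      using T(3,4) ord permutations_of_set_bounds[OF T(2)] by (auto simp: triple_config_def)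
    ultimately have "\<not> steady_state n X"
      by (intro not_steady_stateI[of n X q "q + 3" "q + 2"]) auto
    with medium step show thesis by (rule that)
  qed
qed

section \<open>Words with three increasing runs\<close>

lemma segment_tail:
  assumes "r + int (length u) \<le> k" "k < r + int (length (u @ v))"
  shows "segment n r (u @ v) k \<in> set v"
  using assms segment_in_set[of "r + int (length u)" k v n] by (simp add: segment_append)

lemma segment_init:
  assumes "r \<le> k" "k < r + int (length u)"
  shows "segment n r (u @ v) k \<in> set u"
  using assms segment_in_set[of r k u n] by (simp add: segment_append)

lemma segment_mid: "segment n r (u @ i # v) (r + int (length u)) = i"
  by (simp add: segment_append segment_Cons)

lemma segment_inner:
  "m < length v \<Longrightarrow> segment n r (u @ v @ w) (r + int (length u) + int m) = v ! m"
  by (simp add: segment_def nth_append nat_add_distrib)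

text \<open>The first move of a word gathers a block \<open>d1 @ i # d2\<close> just behind the last box of the word.
  The balls of this block on the left of \<open>i\<close> are smaller than \<open>i\<close> and have landed already; so only
  the letters of the word on the right of \<open>i\<close> need attention.\<close>

lemma sweep_jump_ok:
  assumes w: "length (u @ i # v) = n" "set (u @ i # v) \<subseteq> {1..n}"
    and Y: "\<And>k. int n + 1 \<le> k \<Longrightarrow> Y k = segment n (int n + 1) (d1 @ i # d2) k"
    and d1: "\<And>j. j \<in> set d1 \<Longrightarrow> j < i"
    and later: "\<And>k. int (length u) + 1 < k \<Longrightarrow> k \<le> int n \<Longrightarrow>
       i < segment n 1 (u @ i # v) k \<or> Y k < i"
  shows "jump_ok n (segment n 1 (u @ i # v)) Y i"
proof (rule jump_okI[of _ "1 + int (length u)" _ _ "int n + 1 + int (length d1)"])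
  let ?X = "segment n 1 (u @ i # v)"
  show "?X (1 + int (length u)) = i" by (rule segment_mid)
  show "Y (int n + 1 + int (length d1)) = i" using Y by (simp add: segment_mid)
  show "1 + int (length u) < int n + 1 + int (length d1)" using w(1) by simp
  have "?X (int n + 1 + int (length d1)) = n + 1"
    by (rule segment_outside) (use w(1) in simp)
  then show "?X (int n + 1 + int (length d1)) = n + 1 \<or> ?X (int n + 1 + int (length d1)) < i" ..
  fix k assume k: "1 + int (length u) < k" "k < int n + 1 + int (length d1)"
  show "(i < ?X k \<and> ?X k \<le> n) \<or> Y k < i"
  proof (cases "k \<le> int n")
    case True
    then have "?X k \<in> set (u @ i # v)" using k w(1) by (intro segment_in_set) auto
    then have "?X k \<le> n" using w(2) by auto
    then show ?thesis using later[of k] k True by auto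
  next
    case False
    then have "Y k \<in> set d1" using Y[of k] k segment_init[of "int n + 1" k d1 n "i # d2"] by simp
    then show ?thesis using d1 by blast
  qed
qed

text \<open>The word \<open>[a, b] @ v1 @ c # v2 @ x # xs\<close> has the increasing runs \<open>[a, b]\<close>,
  \<open>v1 @ c # v2\<close> and \<open>x # xs\<close>. Row insertion of the second run bumps \<open>a\<close> and \<open>b\<close> into the second
  row, and insertion of \<open>x\<close> then bumps \<open>c\<close>, which bumps \<open>a\<close> or \<open>b\<close> into the third row. The first
  row at the end is \<open>v1 @ x # v2 @ xs\<close>.\<close>

definition three_run_word :: "nat \<Rightarrow> nat \<Rightarrow> nat \<Rightarrow> nat list \<Rightarrow> nat \<Rightarrow> nat list \<Rightarrow> nat \<Rightarrow> nat list \<Rightarrow> bool" where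
  "three_run_word n a b v1 c v2 x xs \<longleftrightarrow>
     [a, b] @ v1 @ c # v2 @ x # xs \<in> permutations_of_set {1..n} \<and>
     sorted_wrt (<) (v1 @ c # v2) \<and> sorted_wrt (<) (v1 @ x # v2 @ xs) \<and>
     a < b \<and> c < b \<and> x < c \<and> 2 \<le> length (v1 @ c # v2) \<and>
     (v1 @ c # v2) ! 0 < a \<and> (v1 @ c # v2) ! 1 < b"

lemma three_run_word_length:
  assumes "three_run_word n a b v1 c v2 x xs"
  shows "n = length ([a, b] @ v1 @ c # v2 @ x # xs)"
  using assms distinct_card[of "[a, b] @ v1 @ c # v2 @ x # xs"]
  unfolding three_run_word_def by (auto simp: permutations_of_set_def simp del: One_nat_def)

lemma three_run_word_colliding:
  assumes "three_run_word n a b v1 c v2 x xs"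
  shows "colliding (v1 @ x # v2 @ xs) a b c"
proof -
  let ?d = "v1 @ x # v2 @ xs"
  have n: "length ?d = n - 3" "3 \<le> n" using three_run_word_length[OF assms] by auto
  have A: "[a, b] @ v1 @ c # v2 @ x # xs \<in> permutations_of_set {1..n}"
    "sorted_wrt (<) (v1 @ c # v2)" "sorted_wrt (<) ?d"
    "a < b" "c < b" "x < c" "2 \<le> length (v1 @ c # v2)"
    "(v1 @ c # v2) ! 0 < a" "(v1 @ c # v2) ! 1 < b"
    using assms unfolding three_run_word_def by blast+
  have P: "a # c # b # ?d \<in> permutations_of_set {1..n}" "b # a # c # ?d \<in> permutations_of_set {1..n}"
    by (rule permutations_of_set_cong[THEN iffD1, OF _ _ A(1)]; auto)+
  have "a \<noteq> c" using A(1) by (auto simp: permutations_of_set_def)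
  \<comment> \<open>Replacing \<open>c\<close> by the smaller \<open>x\<close> can only lower the first two entries of the second run.\<close>
  have "?d ! 0 < a \<and> ?d ! 0 < c \<and> ?d ! 1 < b \<and> (a < c \<longrightarrow> ?d ! 1 < c)"
  proof (cases v1)
    case Nil
    then obtain y ys where "v2 = y # ys" using A(7) by (cases v2) auto
    then show ?thesis using Nil A by auto
  next
    case (Cons e v1')
    then show ?thesis using A by (cases v1') auto
  qed
  then show ?thesis
    unfolding colliding_def standard_tableau_3_iff[OF n] using A P \<open>a \<noteq> c\<close> by auto
qed

text \<open>The first move carries out the row insertion: each bumped letter is left behind in
  the box of the letter that bumps it, and the first row of the insertion tableau comes to lie directly
  behind the word.\<close>

lemma BB_three_run_word:
  assumes wd: "three_run_word n a b v1 c v2 x xs"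
  defines "w \<equiv> [a, b] @ v1 @ c # v2 @ x # xs" and "d \<equiv> v1 @ x # v2 @ xs"
    and "k \<equiv> length ([a, b] @ v1 @ c # v2)"
  shows "BB n (config_of w) = triple_config n (int k + 1) c 3 a b (int n + 1) d"
proof -
  have n: "length w = n" using three_run_word_length[OF wd] by (simp add: w_def)
  have X: "config_of w = segment n 1 w" by (simp add: config_of_eq_segment n)
  let ?Y = "triple_config n (int k + 1) c 3 a b (int n + 1) d"
  have perm: "w \<in> permutations_of_set {1..n}" and srt: "sorted_wrt (<) (v1 @ c # v2)" "sorted_wrt (<) d"
    and ord: "a < b" "c < b" "x < c" and len: "2 \<le> length (v1 @ c # v2)"
    and below: "(v1 @ c # v2) ! 0 < a" "(v1 @ c # v2) ! 1 < b"
    using wd unfolding three_run_word_def w_def d_def by blast+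
  have perm': "c # a # b # d \<in> permutations_of_set {1..n}"
    by (rule permutations_of_set_cong[THEN iffD1, OF _ _ perm]) (auto simp: w_def d_def)
  have setw: "set w = {1..n}" using permutations_of_setD(1)[OF perm] .
  have le: "c \<le> n" "a \<le> n" "b \<le> n" using permutations_of_set_bounds[OF perm'] .
  have k: "4 \<le> k" "k < n" using len n by (auto simp: k_def w_def)
  have Yk: "?Y j = segment n (int n + 1) d j" if "int n + 1 \<le> j" for j
    using that k by (intro triple_config_segment) auto
  have Xv: "segment n 1 w (3 + int m) = (v1 @ c # v2) ! m" if "m < length (v1 @ c # v2)" for m
    using segment_inner[OF that, of n 1 "[a, b]" "x # xs"] by (simp add: w_def)
  have X34: "segment n 1 w 3 = (v1 @ c # v2) ! 0" "segment n 1 w 4 = (v1 @ c # v2) ! 1"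
  proof -
    have "0 < length (v1 @ c # v2)" "1 < length (v1 @ c # v2)" using len by linarith+
    from this[THEN Xv] show "segment n 1 w 3 = (v1 @ c # v2) ! 0" "segment n 1 w 4 = (v1 @ c # v2) ! 1"
      by simp_all
  qed
  \<comment> \<open>All letters except \<open>a\<close>, \<open>b\<close> and \<open>c\<close> are swept into the block behind the word.\<close>
  have dball: "jump_ok n (segment n 1 w) ?Y i"
    if w: "w = u @ i # v" and d: "d = d1 @ i # d2"
      and later: "\<And>j. int (length u) + 1 < j \<Longrightarrow> j \<le> int n \<Longrightarrow> i < segment n 1 w j \<or> ?Y j < i"
    for i u v d1 d2
    unfolding w
  proof (rule sweep_jump_ok)
    show "length (u @ i # v) = n" using n unfolding w .
    show "set (u @ i # v) \<subseteq> {1..n}" using setw unfolding w by blast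
    show "?Y j = segment n (int n + 1) (d1 @ i # d2) j" if "int n + 1 \<le> j" for j
      using Yk[OF that] d by simp
    show "j < i" if "j \<in> set d1" for j using srt(2) that unfolding d by (auto simp: sorted_wrt_append)
    show "i < segment n 1 (u @ i # v) j \<or> ?Y j < i" if "int (length u) + 1 < j" "j \<le> int n" for j
      using later[OF that] unfolding w .
  qed
  have suffix: "segment n 1 w j \<in> set v" if "w = u @ i # v" "int (length u) + 1 < j" "j \<le> int n" for u i v j
    using segment_tail[of 1 "u @ [i]" j v n] that n by simp
  have "jump_ok n (segment n 1 w) ?Y i" if i: "i \<in> {1..n}" for i
  proof -
    have "i \<in> set w" using i setw by simp
    then consider "i = a" | "i = b" | "i = c" | "i = x" | "i \<in> set v1" | "i \<in> set v2" | "i \<in> set xs"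
      by (auto simp: w_def)
    then show ?thesis
    proof cases
      case 1
      have "segment n 1 w 1 = a" "segment n 1 w (1 + 1) = b" by (simp_all add: w_def segment_Cons)
      moreover have "segment n 1 w (1 + 2) < a" using X34 below(1) by simp
      ultimately show ?thesis using 1 ord le by (intro jump_ok_2[of _ 1]) (auto simp: triple_config_def)
    next
      case 2
      have "segment n 1 w 2 = b" by (simp add: w_def segment_Cons)
      moreover have "segment n 1 w (2 + 2) < b" using X34 below(2) by simp
      ultimately show ?thesis using 2 ord le by (intro jump_ok_2[of _ 2]) (auto simp: triple_config_def)
    next
      case 3
      have w': "w = ([a, b] @ v1) @ c # (v2 @ x # xs)" "w = ([a, b] @ v1 @ c # v2) @ x # xs"
        by (simp_all add: w_def)
      have Xk: "segment n 1 w (int k + 1) = x"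
        unfolding w'(2) k_def using segment_mid[of n 1 "[a, b] @ v1 @ c # v2" x xs] by (simp add: add.commute)
      show ?thesis
      proof (rule jump_okI[of _ "1 + int (length ([a, b] @ v1))" _ _ "int k + 1"])
        show "segment n 1 w (1 + int (length ([a, b] @ v1))) = i" unfolding w'(1) 3 by (rule segment_mid)
        show "?Y (int k + 1) = i" using k 3 by (simp add: triple_config_def)
        show "1 + int (length ([a, b] @ v1)) < int k + 1" by (simp add: k_def)
        show "segment n 1 w (int k + 1) = n + 1 \<or> segment n 1 w (int k + 1) < i" using Xk ord 3 by simp
        fix j assume j: "1 + int (length ([a, b] @ v1)) < j" "j < int k + 1"
        have "segment n 1 (([a, b] @ v1 @ [c]) @ v2) j \<in> set v2"
          using j by (intro segment_tail) (auto simp: k_def)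
        moreover have "segment n 1 w j = segment n 1 (([a, b] @ v1 @ [c]) @ v2) j"
          using j(2) unfolding w'(2) by (subst segment_append) (auto simp: k_def)
        ultimately have *: "segment n 1 w j \<in> set v2" by simp
        then have "c < segment n 1 w j" using srt(1) by (auto simp: sorted_wrt_append)
        moreover have "segment n 1 w j \<in> set w" using * by (auto simp: w_def)
        ultimately show "i < segment n 1 w j \<and> segment n 1 w j \<le> n \<or> ?Y j < i"
          using setw 3 by auto
      qed
    next
      case 4
      have w': "w = ([a, b] @ v1 @ c # v2) @ x # xs" by (simp add: w_def)
      have "i < j" if "j \<in> set xs" for j using srt(2) that 4 by (auto simp: d_def sorted_wrt_append)
      then show ?thesis using 4 suffix[OF w'] by (intro dball[of _ i xs v1 "v2 @ xs"]) (auto simp: w' d_def)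
    next
      case 5
      then obtain u1 u2 where v1: "v1 = u1 @ i # u2" by (metis split_list)
      have w': "w = ([a, b] @ u1) @ i # (u2 @ c # v2 @ x # xs)" by (simp add: w_def v1)
      have "i < j" if "j \<in> set (u2 @ c # v2 @ x # xs)" for j
        using srt that by (auto simp: d_def v1 sorted_wrt_append)
      then show ?thesis using suffix[OF w'] by (intro dball[OF w', of u1 "u2 @ x # v2 @ xs"]) (auto simp: d_def v1)
    next
      case 6
      then obtain u1 u2 where v2: "v2 = u1 @ i # u2" by (metis split_list)
      have w': "w = ([a, b] @ v1 @ c # u1) @ i # (u2 @ x # xs)" by (simp add: w_def v2)
      show ?thesis
      proof (rule dball[OF w', of "v1 @ x # u1" "u2 @ xs"])
        show "d = (v1 @ x # u1) @ i # u2 @ xs" by (simp add: d_def v2)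
        fix j assume j: "int (length ([a, b] @ v1 @ c # u1)) + 1 < j" "j \<le> int n"
        \<comment> \<open>The letter \<open>x\<close> may be smaller than \<open>i\<close>, but then its box has been taken by \<open>c < i\<close>.\<close>
        show "i < segment n 1 w j \<or> ?Y j < i"
        proof (cases "segment n 1 w j = x")
          case True
          have "segment n 1 w (int k + 1) = x"
            using segment_mid[of n 1 "[a, b] @ v1 @ c # v2" x xs] by (simp add: w_def k_def add.commute)
          moreover have "x \<in> {1..n}" using setw by (auto simp: w_def)
          ultimately have "j = int k + 1"
            using segment_ball_config[OF perm, of 1] True unfolding ball_config_def by metis
          then show ?thesis using k srt(1) by (auto simp: triple_config_def v2 sorted_wrt_append)
        next
          case False
          then have "segment n 1 w j \<in> set (u2 @ xs)" using suffix[OF w' j] by auto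
          then show ?thesis using srt(2) by (auto simp: d_def v2 sorted_wrt_append)
        qed
      qed
    next
      case 7
      then obtain u1 u2 where xs: "xs = u1 @ i # u2" by (metis split_list)
      have w': "w = ([a, b] @ v1 @ c # v2 @ x # u1) @ i # u2" by (simp add: w_def xs)
      have "i < j" if "j \<in> set u2" for j
        using srt(2) that by (auto simp: d_def xs sorted_wrt_append)
      then show ?thesis using suffix[OF w']
        by (intro dball[OF w', of "v1 @ x # v2 @ u1" u2]) (auto simp: d_def xs)
    qed
  qed
  moreover have "ball_config n (segment n 1 w)" by (rule segment_ball_config[OF perm])
  moreover have "ball_config n ?Y" by (rule triple_ball_config[OF perm']) (use k in auto)
  ultimately show ?thesis unfolding X by (intro BB_eqI)
qed

text \<open>The pair \<open>a, b\<close> starts in the boxes 3 and 4 and moves at speed 2, the ball \<open>c\<close> starts in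
  box \<open>k + 1\<close> and moves at speed 1, so \<open>c\<close> is directly in front of \<open>b\<close> after \<open>k - 3\<close> moves. The
  block \<open>d\<close> is always ahead of both.\<close>

lemma BB_iterate_three_run_word:
  assumes wd: "three_run_word n a b v1 c v2 x xs"
  defines "w \<equiv> [a, b] @ v1 @ c # v2 @ x # xs" and "d \<equiv> v1 @ x # v2 @ xs"
    and "k \<equiv> length ([a, b] @ v1 @ c # v2)"
  assumes t: "Suc t \<le> k - 3"
  shows "(BB n ^^ Suc t) (config_of w) =
    triple_config n (int k + 1 + int t) c (3 + 2 * int t) a b (int n + 1 + int t * int (length d)) d"
  using t
proof (induction t)
  case 0
  show ?case using BB_three_run_word[OF wd] by (simp add: w_def d_def k_def)
next
  case (Suc t)
  have n: "n = length w" using three_run_word_length[OF wd] by (simp add: w_def)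
  have d: "length d = n - 3" "3 \<le> n" "k < n" "2 \<le> length d"
    using n wd by (auto simp: w_def d_def k_def three_run_word_def)
  have "int k + 1 + int t < int n + 1 + int t * int (length d)"
  proof -
    have "int t * 1 \<le> int t * int (length d)" by (rule mult_left_mono) (use d in auto)
    then show ?thesis using d by linarith
  qed
  moreover have "3 + 2 * int t + 3 \<le> int k + 1 + int t" using Suc.prems by linarith
  moreover have "w \<in> permutations_of_set {1..n}" "sorted_wrt (<) d" "a < b" "c < b"
    using wd unfolding three_run_word_def w_def d_def by blast+
  moreover from this(1) have "c # a # b # d \<in> permutations_of_set {1..n}"
    by (rule permutations_of_set_cong[THEN iffD1, rotated 2]) (auto simp: w_def d_def)
  moreover have "d ! 0 < c"
    using wd by (cases v1) (auto simp: d_def three_run_word_def)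
  ultimately have "BB n (triple_config n (int k + 1 + int t) c (3 + 2 * int t) a b
      (int n + 1 + int t * int (length d)) d) =
    triple_config n (int k + 1 + int t + 1) c (3 + 2 * int t + 2) a b
      (int n + 1 + int t * int (length d) + int (length d)) d"
    using d(4) by (intro BB_approach)
  then show ?case using Suc by (simp add: algebra_simps)
qed

lemma three_run_word_steady_state_time:
  assumes wd: "three_run_word n a b v1 c v2 x xs"
  defines "w \<equiv> [a, b] @ v1 @ c # v2 @ x # xs"
  shows "steady_state_time w = length (v1 @ c # v2) \<and> good_permutation w"
proof -
  define d where "d = v1 @ x # v2 @ xs"
  define k where "k = length ([a, b] @ v1 @ c # v2)"
  define r where "r = int n + 1 + int (k - 4) * int (length d)"
  have n: "n = length w" using three_run_word_length[OF wd] by (simp add: w_def)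
  have k: "4 \<le> k" "k < n" "length (v1 @ c # v2) = Suc (k - 3)" "k - 3 = Suc (k - 4)" "2 \<le> length d"
    using n wd by (auto simp: w_def d_def k_def three_run_word_def)
  have d: "length d = n - 3" "3 \<le> n" using n by (auto simp: w_def d_def)
  have col: "colliding d a b c" unfolding d_def by (rule three_run_word_colliding[OF wd])
  have last: "(BB n ^^ (k - 3)) (config_of w) =
      triple_config n (3 + 2 * int (k - 4) + 2) c (3 + 2 * int (k - 4)) a b r d"
  proof -
    \<comment> \<open>After \<open>k - 3\<close> moves \<open>c\<close> is in the box directly to the right of \<open>b\<close>.\<close>
    have e: "int k + 1 + int (k - 4) = 3 + 2 * int (k - 4) + 2" using k by linarith
    have "Suc (k - 4) \<le> k - 3" using k(4) by simp
    from BB_iterate_three_run_word[OF wd, folded w_def d_def k_def, OF this] show ?thesis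
      unfolding e r_def k(4) .
  qed
  \<comment> \<open>The block \<open>d\<close> has length at least 2, so it is still ahead of \<open>c\<close>.\<close>
  have "int (k - 4) * 2 \<le> int (k - 4) * int (length d)" by (rule mult_left_mono) (use k in auto)
  then have pos: "3 + 2 * int (k - 4) + 2 < r" using k unfolding r_def by linarith
  obtain p q y z x' where std: "standard_tableau [d, [y, z], [x']]"
    and step: "BB n ((BB n ^^ (k - 3)) (config_of w)) = triple_config n p x' q y z (r + int (length d)) d"
    and pq: "p < q" "q + 1 < r + int (length d)"
    and "\<not> steady_state n ((BB n ^^ (k - 3)) (config_of w))"
  proof (rule collision[OF col d pos])
    fix x' y z
    assume "standard_tableau [d, [y, z], [x']]"
      "BB n (triple_config n (3 + 2 * int (k - 4) + 2) c (3 + 2 * int (k - 4)) a b r d) =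
        triple_config n (3 + 2 * int (k - 4) + 2) x' (3 + 2 * int (k - 4) + 3) y z (r + int (length d)) d"
      "\<not> steady_state n (triple_config n (3 + 2 * int (k - 4) + 2) c (3 + 2 * int (k - 4)) a b r d)"
    then show thesis unfolding last[symmetric] using pos k(5)
      by (intro that[where p = "3 + 2 * int (k - 4) + 2" and q = "3 + 2 * int (k - 4) + 3"]) auto
  qed
  then show ?thesis
    using steady_state_time_good[OF n[symmetric] _ std d pq, of "length (v1 @ c # v2)"]
    unfolding k(3) by simp
qed

section \<open>Recording tableaux of prefixes\<close>

text \<open>The insertion tableau is needed alongside the recording tableau in order to follow the
  insertion of the later letters.\<close>

definition rs_rows :: "nat list \<Rightarrow> (nat list \<times> nat list) list" where
  "rs_rows w = fold (\<lambda>(m, x). rs_insert m x) (enumerate 1 w) []"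

lemma recording_tableau_rs_rows: "recording_tableau w = map snd (rs_rows w)"
  by (simp add: recording_tableau_def rs_rows_def)

lemma rs_rows_snoc: "rs_rows (w @ [x]) = rs_insert (length w + 1) x (rs_rows w)"
  by (simp add: rs_rows_def enumerate_append_eq)

definition restrict_tableau :: "nat \<Rightarrow> tableau \<Rightarrow> tableau" where
  "restrict_tableau m T = filter (\<lambda>r. r \<noteq> []) (map (filter (\<lambda>j. j \<le> m)) T)"

definition recorded_up_to :: "nat \<Rightarrow> tableau \<Rightarrow> bool" where
  "recorded_up_to m T \<longleftrightarrow> (\<forall>r\<in>set T. r \<noteq> [] \<and> (\<forall>j\<in>set r. j \<le> m))"

lemma recorded_up_to_simps [simp]:
  "recorded_up_to m []"
  "recorded_up_to m (r # T) \<longleftrightarrow> r \<noteq> [] \<and> (\<forall>j\<in>set r. j \<le> m) \<and> recorded_up_to m T"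
  by (auto simp: recorded_up_to_def)

lemma restrict_tableau_simps [simp]:
  "restrict_tableau m [] = []"
  "restrict_tableau m (r # T) =
     (if filter (\<lambda>j. j \<le> m) r = [] then restrict_tableau m T
      else filter (\<lambda>j. j \<le> m) r # restrict_tableau m T)"
  by (auto simp: restrict_tableau_def)

lemma recorded_up_to_mono: "recorded_up_to l T \<Longrightarrow> l \<le> m \<Longrightarrow> recorded_up_to m T"
  by (fastforce simp: recorded_up_to_def)

lemma restrict_tableau_id: "recorded_up_to m T \<Longrightarrow> restrict_tableau m T = T"
  by (induction T) (auto cong: filter_cong)

lemma rs_insert_records:
  assumes "recorded_up_to l (map snd S)" "l < m"
  shows "recorded_up_to m (map snd (rs_insert m x S)) \<and>
    restrict_tableau l (map snd (rs_insert m x S)) = map snd S \<and>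
    length (concat (map snd (rs_insert m x S))) = Suc (length (concat (map snd S)))"
  using assms
proof (induction m x S rule: rs_insert.induct)
  case (1 m x)
  then show ?case by simp
next
  case (2 m x p q rows)
  have q: "q \<noteq> []" "\<forall>j\<in>set q. j \<le> l" and rows: "recorded_up_to l (map snd rows)"
    using 2(2) by simp_all
  have fq: "filter (\<lambda>j. j \<le> l) q = q" using q(2) by (simp add: filter_id_conv)
  have qm: "\<forall>j\<in>set q. j \<le> m" using q(2) 2(3) by auto
  have rows': "restrict_tableau l (map snd rows) = map snd rows" "recorded_up_to m (map snd rows)"
    using restrict_tableau_id[OF rows] recorded_up_to_mono[OF rows] 2(3) by simp_all
  show ?case
  proof (cases "dropWhile (\<lambda>y. y < x) p")
    case Nil
    then have "rs_insert m x ((p, q) # rows) = (p @ [x], q @ [m]) # rows"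
      by (simp only: rs_insert.simps list.case)
    then show ?thesis using q fq qm rows' 2(3) by simp
  next
    case (Cons y ys)
    then have "rs_insert m x ((p, q) # rows) =
        (takeWhile (\<lambda>y. y < x) p @ x # ys, q) # rs_insert m y rows" by simp
    then show ?thesis using 2(1)[OF Cons rows 2(3)] q fq qm by simp
  qed
qed

lemma recording_tableau_records:
  "recorded_up_to (length w) (recording_tableau w) \<and>
   length (concat (recording_tableau w)) = length w"
proof (induction w rule: rev_induct)
  case Nil
  then show ?case by (simp add: recording_tableau_def recorded_up_to_def)
next
  case (snoc x w)
  then show ?case
    using rs_insert_records[of "length w" "rs_rows w" "length w + 1" x]
    by (simp add: recording_tableau_rs_rows rs_rows_snoc)
qed

text \<open>Insertion only ever adds cells with larger entries, so a prescribed recording tableau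
  prescribes the recording tableaux of all prefixes. This lets a word be reconstructed from
  its recording tableau letter by letter.\<close>

lemma recording_tableau_prefix:
  "recording_tableau u = restrict_tableau (length u) (recording_tableau (u @ v))"
proof (induction v rule: rev_induct)
  case Nil
  then show ?case using restrict_tableau_id[of "length u" "recording_tableau u"]
      recording_tableau_records[of u] by simp
next
  case (snoc x v)
  have "recording_tableau (u @ v) = restrict_tableau (length (u @ v)) (recording_tableau (u @ v @ [x]))"
    using rs_insert_records[of "length (u @ v)" "rs_rows (u @ v)" "length (u @ v) + 1" x]
      recording_tableau_records[of "u @ v"]
    by (simp add: recording_tableau_rs_rows rs_rows_snoc flip: append_assoc)
  moreover have "restrict_tableau (length u) (restrict_tableau (length (u @ v)) T) = restrict_tableau (length u) T" for T
  proof (induction T)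
    case (Cons r T)
    have "filter (\<lambda>j. j \<le> length u) (filter (\<lambda>j. j \<le> length (u @ v)) r) = filter (\<lambda>j. j \<le> length u) r"
      by (auto intro!: filter_cong)
    then show ?case using Cons by (auto simp: filter_empty_conv)
  qed simp
  ultimately show ?case using snoc by metis
qed

lemma rs_rows_append_increasing:
  assumes "rs_rows u = (p, q) # S" "sorted_wrt (<) (p @ xs)"
    and "l = length u + 1" "m = length u + length xs + 1"
  shows "rs_rows (u @ xs) = (p @ xs, q @ [l..<m]) # S"
  using assms(2) unfolding assms(3,4)
proof (induction xs rule: rev_induct)
  case Nil
  then show ?case using assms(1) by simp
next
  case (snoc x xs)
  let ?q = "q @ [length u + 1..<length u + length xs + 1]"
  have "dropWhile (\<lambda>y. y < x) (p @ xs) = []" "sorted_wrt (<) (p @ xs)"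
    using snoc.prems by (auto simp: sorted_wrt_append)
  then have "rs_insert (length (u @ xs) + 1) x ((p @ xs, ?q) # S) =
      ((p @ xs) @ [x], ?q @ [length (u @ xs) + 1]) # S"
    by (simp only: rs_insert.simps list.case)
  moreover have "rs_rows (u @ xs) = (p @ xs, ?q) # S" by (rule snoc.IH) fact
  ultimately show ?case using rs_rows_snoc[of "u @ xs" x] by simp
qed

text \<open>Conversely, if all new cells appear at the end of the first row, no letter bumped another
  one, so the new letters continue the first row increasingly.\<close>

lemma increasing_if_recorded_in_first_row:
  assumes "rs_rows u = (p, q) # S" "sorted_wrt (<) p"
    and "recording_tableau (u @ xs) = (q @ [l..<m]) # map snd S"
    and "l = length u + 1" "m = length u + length xs + 1"
  shows "sorted_wrt (<) (p @ xs)"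
  using assms(3) unfolding assms(4,5)
proof (induction xs rule: rev_induct)
  case Nil
  then show ?case using assms(2) by simp
next
  case (snoc x xs)
  let ?q = "q @ [length u + 1..<length u + length xs + 1]"
  have "recorded_up_to (length u) (q # map snd S)"
    using recording_tableau_records[of u] assms(1) by (simp add: recording_tableau_rs_rows)
  then have old: "recorded_up_to (length (u @ xs)) (?q # map snd S)"
    using recorded_up_to_mono[of "length u" "map snd S" "length (u @ xs)"] by auto
  have "recording_tableau (u @ xs) = restrict_tableau (length (u @ xs)) ((?q @ [length (u @ xs) + 1]) # map snd S)"
    using recording_tableau_prefix[of "u @ xs" "[x]"] snoc.prems by simp
  also have "\<dots> = restrict_tableau (length (u @ xs)) (?q # map snd S)"
    by simp
  also have "\<dots> = ?q # map snd S"
    using restrict_tableau_id[OF old] by simp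
  finally have srt: "sorted_wrt (<) (p @ xs)" by (rule snoc.IH)
  have "rs_rows (u @ xs @ [x]) = rs_insert (length (u @ xs) + 1) x ((p @ xs, ?q) # S)"
    using rs_rows_append_increasing[OF assms(1) srt refl refl] rs_rows_snoc[of "u @ xs" x] by simp
  then have "hd (map snd (rs_insert (length (u @ xs) + 1) x ((p @ xs, ?q) # S))) = ?q @ [length (u @ xs) + 1]"
    using snoc.prems by (simp add: recording_tableau_rs_rows)
  then have "dropWhile (\<lambda>y. y < x) (p @ xs) = []"
    by (auto split: list.splits)
  then show ?case using srt by (auto simp: sorted_wrt_append)
qed

section \<open>Words with prescribed recording tableau\<close>

lemma recording_tableau_snoc:
  "rs_rows u = S \<Longrightarrow> recording_tableau (u @ [x]) = map snd (rs_insert (length u + 1) x S)"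
  by (simp add: recording_tableau_rs_rows rs_rows_snoc)

lemma recording_tableau_2:
  "recording_tableau [x, y] = [[1, 2]] \<longleftrightarrow> x < y"
  "recording_tableau [x, y] = [[1], [2]] \<longleftrightarrow> \<not> x < y"
  by (simp_all add: recording_tableau_def)

lemma rs_rows_2:
  "rs_rows [x, y] = (if x < y then [([x, y], [1, 2])] else [([y], [1]), ([x], [2])])"
  by (simp add: rs_rows_def)

text \<open>The start of the words for \<open>Q_chain\<close>. The alternatives in which the third letter bumps
  \<open>b\<close> instead of \<open>a\<close> die with the fourth letter, which would have to open a third row.\<close>

lemma record_12_34:
  assumes "distinct [a, b, e, f]"
  shows "recording_tableau [a, b, e, f] = [[1, 2], [3, 4]] \<longleftrightarrow> a < b \<and> e < a \<and> e < f \<and> f < b" (is "?L \<longleftrightarrow> ?R")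
    and "a < b \<and> e < a \<and> e < f \<and> f < b \<Longrightarrow>
       rs_rows [a, b, e, f] = [([e, f], [1, 2]), ([a, b], [3, 4])]"
proof -
  show rows: "rs_rows [a, b, e, f] = [([e, f], [1, 2]), ([a, b], [3, 4])]" if ?R
    using that rs_rows_snoc[of "[a, b]" e] rs_rows_snoc[of "[a, b, e]" f] by (simp add: rs_rows_2)
  show "?L \<longleftrightarrow> ?R"
  proof
    assume L: ?L
    have 1: "a < b" using recording_tableau_prefix[of "[a, b]" "[e, f]"] L
      by (simp add: recording_tableau_2[simplified])
    have 2: "recording_tableau ([a, b] @ [e]) = [[1, 2], [3]]"
      using recording_tableau_prefix[of "[a, b, e]" "[f]"] L by simp
    have "e < b" using 2 recording_tableau_snoc[OF rs_rows_2, of a b e] 1 assms by (auto split: if_splits)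
    then have "rs_rows [a, b, e] =
       (if e < a then [([e, b], [1, 2]), ([a], [3])] else [([a, e], [1, 2]), ([b], [3])])"
      using 1 rs_rows_snoc[of "[a, b]" e] assms by (auto simp: rs_rows_2)
    from recording_tableau_snoc[OF this, of f] show ?R
      using L 1 \<open>e < b\<close> assms by (auto split: if_splits)
  qed (simp add: rows recording_tableau_rs_rows)
qed

text \<open>The start of the words for \<open>Q0\<close>. Besides \<open>e < y\<close>, the fourth letter may also satisfy
  \<open>y < e < z < x\<close> to open the third row, but then the fifth letter cannot extend the second one.\<close>

lemma record_13_25_4:
  assumes "distinct [x, y, z, e, f]"
  shows "recording_tableau [x, y, z, e, f] = [[1, 3], [2, 5], [4]] \<longleftrightarrow>
      e < y \<and> y < x \<and> y < z \<and> e < f \<and> f < z" (is "?L \<longleftrightarrow> ?R")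
    and "e < y \<and> y < x \<and> y < z \<and> e < f \<and> f < z \<Longrightarrow>
       rs_rows [x, y, z, e, f] = [([e, f], [1, 3]), ([y, z], [2, 5]), ([x], [4])]"
proof -
  show rows: "rs_rows [x, y, z, e, f] = [([e, f], [1, 3]), ([y, z], [2, 5]), ([x], [4])]" if ?R
    using that rs_rows_snoc[of "[x, y]" z] rs_rows_snoc[of "[x, y, z]" e] rs_rows_snoc[of "[x, y, z, e]" f]
    by (simp add: rs_rows_2)
  show "?L \<longleftrightarrow> ?R"
  proof
    assume L: ?L
    have "\<not> x < y" using recording_tableau_prefix[of "[x, y]" "[z, e, f]"] L
      by (simp add: recording_tableau_2[simplified])
    moreover have "x \<noteq> y" using assms by simp
    ultimately have 1: "y < x" by linarith
    have 2: "recording_tableau ([x, y] @ [z]) = [[1, 3], [2]]"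
      "recording_tableau ([x, y, z] @ [e]) = [[1, 3], [2], [4]]"
      using recording_tableau_prefix[of "[x, y, z]" "[e, f]"]
        recording_tableau_prefix[of "[x, y, z, e]" "[f]"] L by simp_all
    have yz: "y < z" using 2(1) recording_tableau_snoc[OF rs_rows_2, of x y z] 1 assms
      by (auto split: if_splits)
    then have rows3: "rs_rows [x, y, z] = [([y, z], [1, 3]), ([x], [2])]"
      using 1 rs_rows_snoc[of "[x, y]" z] by (simp add: rs_rows_2)
    have ez: "e < y \<or> (e < z \<and> z < x)"
      using 2(2) recording_tableau_snoc[OF rows3, of e] 1 yz assms by (auto split: if_splits)
    then have "rs_rows [x, y, z, e] = (if e < y then [([e, z], [1, 3]), ([y], [2]), ([x], [4])]
       else [([y, e], [1, 3]), ([z], [2]), ([x], [4])])"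
      using 1 yz rs_rows_snoc[of "[x, y, z]" e] rows3 assms by auto
    from recording_tableau_snoc[OF this, of f] show ?R
      using L 1 yz ez assms by (auto split: if_splits)
  qed (simp add: rows recording_tableau_rs_rows)
qed

text \<open>The start of the words for \<open>Q2\<close>. Here both the order \<open>c < a\<close> and the order \<open>a < c\<close> of the
  third letter occur, and they correspond to the two kinds of collision.\<close>

lemma record_12_35_4:
  assumes "distinct [a, b, c, e, f]"
  shows "recording_tableau [a, b, c, e, f] = [[1, 2], [3, 5], [4]] \<longleftrightarrow>
      a < b \<and> c < b \<and> e < a \<and> e < c \<and> e < f \<and> f < b \<and> (a < c \<longrightarrow> f < c)" (is "?L \<longleftrightarrow> ?R")
    and "a < b \<and> c < b \<and> e < a \<and> e < c \<and> e < f \<and> f < b \<and> (a < c \<longrightarrow> f < c) \<Longrightarrow>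
       rs_rows [a, b, c, e, f] = (if c < a then [([e, f], [1, 2]), ([c, b], [3, 5]), ([a], [4])]
          else [([e, f], [1, 2]), ([a, c], [3, 5]), ([b], [4])])"
proof -
  show rows: "rs_rows [a, b, c, e, f] = (if c < a then [([e, f], [1, 2]), ([c, b], [3, 5]), ([a], [4])]
          else [([e, f], [1, 2]), ([a, c], [3, 5]), ([b], [4])])" if ?R
    using that rs_rows_snoc[of "[a, b]" c] rs_rows_snoc[of "[a, b, c]" e] rs_rows_snoc[of "[a, b, c, e]" f]
      assms by (cases "c < a") (simp_all add: rs_rows_2)
  show "?L \<longleftrightarrow> ?R"
  proof
    assume L: ?L
    have 1: "a < b" using recording_tableau_prefix[of "[a, b]" "[c, e, f]"] L assms
      by (auto simp: recording_tableau_2[simplified])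
    have 2: "recording_tableau ([a, b] @ [c]) = [[1, 2], [3]]"
      "recording_tableau ([a, b, c] @ [e]) = [[1, 2], [3], [4]]"
      using recording_tableau_prefix[of "[a, b, c]" "[e, f]"]
        recording_tableau_prefix[of "[a, b, c, e]" "[f]"] L by simp_all
    have cb: "c < b" using 2(1) recording_tableau_snoc[OF rs_rows_2, of a b c] 1 assms by (auto split: if_splits)
    then have rows3: "rs_rows [a, b, c] =
       (if c < a then [([c, b], [1, 2]), ([a], [3])] else [([a, c], [1, 2]), ([b], [3])])"
      using 1 rs_rows_snoc[of "[a, b]" c] assms by (auto simp: rs_rows_2)
    show ?R
    proof (cases "c < a")
      case True
      then have rows3: "rs_rows [a, b, c] = [([c, b], [1, 2]), ([a], [3])]" using rows3 by simp
      have e: "e < c" using 2(2) recording_tableau_snoc[OF rows3, of e] True 1 cb assms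
        by (auto split: if_splits)
      then have "rs_rows [a, b, c, e] = [([e, b], [1, 2]), ([c], [3]), ([a], [4])]"
        using True rs_rows_snoc[of "[a, b, c]" e] rows3 by auto
      from recording_tableau_snoc[OF this, of f] show ?R
        using L True 1 cb e assms by (auto split: if_splits)
    next
      case False
      then have rows3: "rs_rows [a, b, c] = [([a, c], [1, 2]), ([b], [3])]" using rows3 by simp
      have e: "e < c" using 2(2) recording_tableau_snoc[OF rows3, of e] False 1 cb assms
        by (auto split: if_splits)
      then have "rs_rows [a, b, c, e] = (if e < a then [([e, c], [1, 2]), ([a], [3]), ([b], [4])]
         else [([a, e], [1, 2]), ([c], [3]), ([b], [4])])"
        using False 1 cb rs_rows_snoc[of "[a, b, c]" e] rows3 assms by auto
      from recording_tableau_snoc[OF this, of f] show ?R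
        using L False 1 cb e assms by (auto split: if_splits)
    qed
  qed (simp add: rows recording_tableau_rs_rows)
qed

text \<open>The letter \<open>c\<close> bumped from the first row must in turn bump \<open>a\<close> or \<open>b\<close>, and the letter bumped
  last opens the third row.\<close>

lemma rs_insert_third_row_iff:
  assumes "a < b" "a \<notin> set p" "b \<notin> set p"
  shows "map snd (rs_insert m x [(p, q), ([a, b], r)]) = [q, r, [m]] \<longleftrightarrow>
    (\<exists>c v2. dropWhile (\<lambda>y. y < x) p = c # v2 \<and> c < b)"
proof (cases "dropWhile (\<lambda>y. y < x) p")
  case Nil
  then have "rs_insert m x [(p, q), ([a, b], r)] = [(p @ [x], q @ [m]), ([a, b], r)]"
    by (simp only: rs_insert.simps list.case)
  then show ?thesis unfolding Nil by simp
next
  case (Cons c v2)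
  then have "c \<in> set p" by (metis list.set_intros(1) set_dropWhileD)
  then have "c \<noteq> a" "c \<noteq> b" using assms by auto
  then show ?thesis using assms Cons by auto
qed

text \<open>Closed forms of \<open>\<sigma>\<^sub>2 (Q\<^sub>0)\<close> and of \<open>\<sigma>\<^sub>k \<dots> \<sigma>\<^sub>5 \<sigma>\<^sub>4 \<sigma>\<^sub>2 (Q\<^sub>0)\<close>.\<close>

definition Q2 :: "nat \<Rightarrow> tableau" where
  "Q2 n = [1 # 2 # [6..<n + 1], [3, 5], [4]]"

definition Q_chain :: "nat \<Rightarrow> nat \<Rightarrow> tableau" where
  "Q_chain n k = [1 # 2 # [5..<k + 1] @ [k + 2..<n + 1], [3, 4], [k + 1]]"

lemma filter_upt_le: "filter (\<lambda>j. j \<le> m) [a..<b] = [a..<min b (m + 1)]"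
  by (induction b) (auto simp: min_def le_Suc_eq)

lemma recording_tableau_prefix_eq:
  "recording_tableau w = T \<Longrightarrow> w = u @ v \<Longrightarrow> length u = m \<Longrightarrow> recording_tableau u = restrict_tableau m T"
  using recording_tableau_prefix by blast

lemma rs_rows_snoc_eq: "rs_rows u = S \<Longrightarrow> m = length u + 1 \<Longrightarrow> rs_rows (u @ [x]) = rs_insert m x S"
  by (simp add: rs_rows_snoc)

lemma length_eq_if_recording_tableau:
  "recording_tableau w = T \<Longrightarrow> length (concat T) = n \<Longrightarrow> length w = n"
  using recording_tableau_records[of w] by simp

lemma length_ge_5E:
  assumes "5 \<le> length w"
  obtains a b c e f w' where "w = a # b # c # e # f # w'"
  using assms by (auto simp: Suc_le_length_iff numeral_eq_Suc)

text \<open>These are the row reading words: \<open>y\<close> bumps \<open>x\<close>, the first letter of \<open>d\<close> bumps \<open>y\<close> and with it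
  \<open>x\<close>, the second one bumps \<open>z\<close>, and the rest of \<open>d\<close> is appended to the first row.\<close>

lemma recording_Q0_iff:
  assumes n: "5 \<le> n" and w: "permutation w" "length w = n"
  shows "recording_tableau w = Q0 n \<longleftrightarrow>
    (\<exists>x y z d. w = x # y # z # d \<and> standard_tableau [d, [y, z], [x]])" (is "?L \<longleftrightarrow> ?R")
proof -
  have perm: "w \<in> permutations_of_set {1..n}" using w by (simp add: permutation_def)
  obtain x y z e f w' where w': "w = x # y # z # e # f # w'" using length_ge_5E w n by metis
  have len: "length (e # f # w') = n - 3" "3 \<le> n" using w w' n by auto
  have dist: "distinct [x, y, z, e, f]" using permutations_of_setD(2)[OF perm] w' by auto
  have T: "Q0 n = ([1, 3] @ [6..<n + 1]) # map snd [([y, z], [2, 5]), ([x], [4])]" by (simp add: Q0_def)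
  have lm: "6 = length [x, y, z, e, f] + 1" "n + 1 = length [x, y, z, e, f] + length w' + 1"
    using w(2) w' by simp_all
  have std: "standard_tableau [e # f # w', [y, z], [x]] \<longleftrightarrow>
     (e < y \<and> y < x \<and> y < z \<and> e < f \<and> f < z) \<and> sorted_wrt (<) ([e, f] @ w')"
    unfolding standard_tableau_3_iff[OF len] using perm w' by auto
  have "?L \<longleftrightarrow> standard_tableau [e # f # w', [y, z], [x]]"
  proof
    assume L: ?L
    have "recording_tableau [x, y, z, e, f] = restrict_tableau 5 (Q0 n)"
      by (rule recording_tableau_prefix_eq[OF L, of _ w']) (simp_all add: w')
    then have "recording_tableau [x, y, z, e, f] = [[1, 3], [2, 5], [4]]" by (simp add: Q0_def filter_upt_le)
    then have ord: "e < y \<and> y < x \<and> y < z \<and> e < f \<and> f < z" using record_13_25_4(1)[OF dist] by blast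
    have "sorted_wrt (<) ([e, f] @ w')"
      by (rule increasing_if_recorded_in_first_row[OF record_13_25_4(2)[OF dist ord] _ _ lm])
        (use L w' T ord in auto)
    then show "standard_tableau [e # f # w', [y, z], [x]]" using ord std by blast
  next
    assume "standard_tableau [e # f # w', [y, z], [x]]"
    then have ord: "e < y \<and> y < x \<and> y < z \<and> e < f \<and> f < z" and srt: "sorted_wrt (<) ([e, f] @ w')"
      using std by blast+
    show ?L
      using rs_rows_append_increasing[OF record_13_25_4(2)[OF dist ord] srt lm]
      unfolding recording_tableau_rs_rows T w' by simp
  qed
  then show ?thesis unfolding w' by auto
qed

text \<open>The words for \<open>Q2\<close> are those that start with a collision: the letter \<open>c\<close> stands directly in
  front of the pair \<open>a, b\<close> that is going to reach it.\<close>

lemma recording_Q2_iff: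
  assumes n: "5 \<le> n" and w: "permutation w" "length w = n"
  shows "recording_tableau w = Q2 n \<longleftrightarrow>
    (\<exists>a b c d. w = a # b # c # d \<and> colliding d a b c)" (is "?L \<longleftrightarrow> ?R")
proof -
  have perm: "w \<in> permutations_of_set {1..n}" using w by (simp add: permutation_def)
  obtain a b c e f w' where w': "w = a # b # c # e # f # w'" using length_ge_5E w n by metis
  have len: "length (e # f # w') = n - 3" "3 \<le> n" using w w' n by auto
  have dist: "distinct [a, b, c, e, f]" using permutations_of_setD(2)[OF perm] w' by auto
  have perm': "a # c # b # e # f # w' \<in> permutations_of_set {1..n}"
    "b # a # c # e # f # w' \<in> permutations_of_set {1..n}"
    by (rule permutations_of_set_cong[THEN iffD1, OF _ _ perm]; auto simp: w')+
  have T: "Q2 n = ([1, 2] @ [6..<n + 1]) # [[3, 5], [4]]" by (simp add: Q2_def)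
  have lm: "6 = length [a, b, c, e, f] + 1" "n + 1 = length [a, b, c, e, f] + length w' + 1"
    using w(2) w' by simp_all
  let ?ord = "a < b \<and> c < b \<and> e < a \<and> e < c \<and> e < f \<and> f < b \<and> (a < c \<longrightarrow> f < c)"
  have col: "colliding (e # f # w') a b c \<longleftrightarrow> ?ord \<and> sorted_wrt (<) ([e, f] @ w')"
    unfolding colliding_def standard_tableau_3_iff[OF len] using perm' dist by auto
  define S where "S = (if c < a then [([c, b], [3, 5]), ([a], [4])] else [([a, c], [3, 5]), ([b], [4::nat])])"
  have S: "map snd S = [[3, 5], [4]]" by (simp add: S_def)
  have rs5: "rs_rows [a, b, c, e, f] = ([e, f], [1, 2]) # S" if ?ord
    using record_12_35_4(2)[OF dist that] by (simp add: S_def)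
  have "?L \<longleftrightarrow> colliding (e # f # w') a b c"
  proof
    assume L: ?L
    have "recording_tableau [a, b, c, e, f] = restrict_tableau 5 (Q2 n)"
      by (rule recording_tableau_prefix_eq[OF L, of _ w']) (simp_all add: w')
    then have "recording_tableau [a, b, c, e, f] = [[1, 2], [3, 5], [4]]" by (simp add: Q2_def filter_upt_le)
    then have ord: ?ord using record_12_35_4(1)[OF dist] by blast
    have "sorted_wrt (<) ([e, f] @ w')"
      by (rule increasing_if_recorded_in_first_row[OF rs5[OF ord] _ _ lm])
        (use ord L w' T S in auto)
    then show "colliding (e # f # w') a b c" using ord col by blast
  next
    assume "colliding (e # f # w') a b c"
    then have ord: ?ord and srt: "sorted_wrt (<) ([e, f] @ w')"
      using col by blast+
    show ?L
      using rs_rows_append_increasing[OF rs5[OF ord] srt lm] S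
      unfolding recording_tableau_rs_rows T w' by simp
  qed
  then show ?thesis unfolding w' by auto
qed

lemma recording_Q_chain_if_three_run_word:
  assumes wd: "three_run_word n a b v1 c v2 x xs"
  defines "w \<equiv> [a, b] @ v1 @ c # v2 @ x # xs" and "k \<equiv> length ([a, b] @ v1 @ c # v2)"
  shows "recording_tableau w = Q_chain n k"
proof -
  have n: "length w = n" using three_run_word_length[OF wd] by (simp add: w_def)
  have A: "w \<in> permutations_of_set {1..n}" "sorted_wrt (<) (v1 @ c # v2)" "sorted_wrt (<) (v1 @ x # v2 @ xs)"
    "a < b" "c < b" "x < c" "2 \<le> length (v1 @ c # v2)"
    "(v1 @ c # v2) ! 0 < a" "(v1 @ c # v2) ! 1 < b"
    using wd unfolding three_run_word_def w_def by blast+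
  have dist: "distinct w" using permutations_of_setD(2)[OF A(1)] .
  obtain e f v' where v: "v1 @ c # v2 = e # f # v'"
    using A(7) by (metis One_nat_def Suc_1 Suc_le_length_iff)
  have w: "w = ([a, b, e, f] @ v' @ [x]) @ xs" using v by (simp add: w_def flip: append_Cons append_assoc)
  have k: "k = length v' + 4" using arg_cong[OF v, of length] by (simp add: k_def)
  have "distinct [a, b, e, f]" using dist w by auto
  moreover have "a < b \<and> e < a \<and> e < f \<and> f < b" using A v by simp
  ultimately have rs4: "rs_rows [a, b, e, f] = [([e, f], [1, 2]), ([a, b], [3, 4])]"
    by (rule record_12_34(2))
  have "rs_rows ([a, b, e, f] @ v') = [([e, f] @ v', [1, 2] @ [5..<k + 1]), ([a, b], [3, 4])]"
    by (rule rs_rows_append_increasing[OF rs4]) (use A(2) v k in simp_all)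
  then have rsk: "rs_rows ([a, b, e, f] @ v') = [(v1 @ c # v2, 1 # 2 # [5..<k + 1]), ([a, b], [3, 4])]"
    by (simp add: v)
  have drop: "dropWhile (\<lambda>y. y < x) (v1 @ c # v2) = c # v2" "takeWhile (\<lambda>y. y < x) (v1 @ c # v2) = v1"
    using A(3,6) by (auto simp: sorted_wrt_append dropWhile_append2 takeWhile_append2)
  have "rs_rows (([a, b, e, f] @ v') @ [x]) = rs_insert (k + 1) x [(v1 @ c # v2, 1 # 2 # [5..<k + 1]), ([a, b], [3, 4])]"
    by (rule rs_rows_snoc_eq[OF rsk]) (simp add: k)
  then have rsk1: "rs_rows (([a, b, e, f] @ v') @ [x]) =
      (v1 @ x # v2, 1 # 2 # [5..<k + 1]) # rs_insert (k + 1) c [([a, b], [3, 4])]"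
    by (simp only: rs_insert.simps drop list.case)
  have rest: "map snd (rs_insert (k + 1) c [([a, b], [3, 4])]) = [[3, 4], [k + 1]]"
    using A(4,5) by auto
  have "n = k + 1 + length xs" using n w k by simp
  then have "rs_rows ((([a, b, e, f] @ v') @ [x]) @ xs) =
      ((v1 @ x # v2) @ xs, (1 # 2 # [5..<k + 1]) @ [k + 2..<n + 1])
       # rs_insert (k + 1) c [([a, b], [3, 4])]"
    by (intro rs_rows_append_increasing[OF rsk1]) (use A(3) k in simp_all)
  moreover have "w = (([a, b, e, f] @ v') @ [x]) @ xs" using w by simp
  ultimately show ?thesis unfolding recording_tableau_rs_rows using rest by (simp add: Q_chain_def)
qed

text \<open>The cell \<open>k + 1\<close> in the third row marks the start \<open>x\<close> of the last run, and \<open>c\<close> is the letter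
  of the second run that \<open>x\<close> bumps. The letters after the fourth one, except \<open>x\<close>, are appended to
  the first row.\<close>

lemma three_run_word_if_recording_Q_chain:
  assumes k: "4 \<le> k" "k < n" and w: "permutation w" "length w = n" and rec: "recording_tableau w = Q_chain n k"
  obtains a b v1 c v2 x xs where "three_run_word n a b v1 c v2 x xs"
    and "w = [a, b] @ v1 @ c # v2 @ x # xs" and "k = length ([a, b] @ v1 @ c # v2)"
proof -
  have perm: "w \<in> permutations_of_set {1..n}" using w by (simp add: permutation_def)
  have dist: "distinct w" using permutations_of_setD(2)[OF perm] .
  have "5 \<le> length w" using w(2) k by simp
  then obtain a b e f g w' where "w = a # b # e # f # g # w'" by (rule length_ge_5E)
  then obtain w4 where w4: "w = [a, b, e, f] @ w4" by simp
  define v' where "v' = take (k - 4) w4"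
  have "drop (k - 4) w4 \<noteq> []" using w4 w k by auto
  then obtain x xs where "drop (k - 4) w4 = x # xs" by (cases "drop (k - 4) w4") auto
  then have w': "w = (([a, b, e, f] @ v') @ [x]) @ xs" using w4 unfolding v'_def by (metis append.assoc append_Cons append_Nil append_take_drop_id)
  have lv: "length v' = k - 4" using w4 w k by (auto simp: v'_def)
  have n: "n = k + 1 + length xs" using w(2) w' lv k by simp
  have "recording_tableau [a, b, e, f] = restrict_tableau 4 (Q_chain n k)"
    by (rule recording_tableau_prefix_eq[OF rec, of _ "v' @ [x] @ xs"]) (simp_all add: w')
  then have "recording_tableau [a, b, e, f] = [[1, 2], [3, 4]]" using k by (simp add: Q_chain_def filter_upt_le)
  moreover have dist4: "distinct [a, b, e, f]" using dist w' by auto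
  ultimately have ord: "a < b \<and> e < a \<and> e < f \<and> f < b" using record_12_34(1) by blast
  have rs4: "rs_rows [a, b, e, f] = [([e, f], [1, 2]), ([a, b], [3, 4])]"
    by (rule record_12_34(2)[OF dist4 ord])
  have "recording_tableau ([a, b, e, f] @ v') = restrict_tableau k (Q_chain n k)"
    by (rule recording_tableau_prefix_eq[OF rec, of _ "[x] @ xs"]) (use lv k in \<open>simp_all add: w'\<close>)
  also have "\<dots> = ([1, 2] @ [5..<k + 1]) # map snd [([a, b], [3, 4])]"
    using k by (simp add: Q_chain_def filter_upt_le)
  finally have srt: "sorted_wrt (<) ([e, f] @ v')"
    by (rule increasing_if_recorded_in_first_row[OF rs4, rotated]) (use ord lv k in auto)
  have rsk: "rs_rows ([a, b, e, f] @ v') = [([e, f] @ v', 1 # 2 # [5..<k + 1]), ([a, b], [3, 4])]"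
    using rs_rows_append_increasing[OF rs4 srt, of 5 "k + 1"] lv k by simp
  have "recording_tableau (([a, b, e, f] @ v') @ [x]) = restrict_tableau (k + 1) (Q_chain n k)"
    by (rule recording_tableau_prefix_eq[OF rec w']) (use lv k in simp)
  also have "\<dots> = [1 # 2 # [5..<k + 1], [3, 4], [k + 1]]"
    using k by (simp add: Q_chain_def filter_upt_le)
  finally have "map snd (rs_insert (k + 1) x [([e, f] @ v', 1 # 2 # [5..<k + 1]), ([a, b], [3, 4])]) =
      [1 # 2 # [5..<k + 1], [3, 4], [k + 1]]"
    using rs_rows_snoc_eq[OF rsk, of "k + 1" x] lv k unfolding recording_tableau_rs_rows by simp
  \<comment> \<open>\<open>v1\<close> consists of the letters of the second run below \<open>x\<close>, and \<open>c\<close> is the next one.\<close>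
  then obtain c v2 where c: "dropWhile (\<lambda>y. y < x) ([e, f] @ v') = c # v2" "c < b"
    using rs_insert_third_row_iff[of a b "[e, f] @ v'"] ord dist w' by auto
  define v1 where "v1 = takeWhile (\<lambda>y. y < x) ([e, f] @ v')"
  have v: "[e, f] @ v' = v1 @ c # v2" unfolding v1_def c(1)[symmetric] by simp
  have v1: "\<forall>y\<in>set v1. y < x" unfolding v1_def by (meson set_takeWhileD)
  have "\<not> c < x" using hd_dropWhile[of "\<lambda>y. y < x" "[e, f] @ v'"] c(1) by simp
  moreover have "c \<noteq> x"
  proof -
    have "x \<notin> set ([e, f] @ v')" using dist w' by auto
    then show ?thesis unfolding v by auto
  qed
  ultimately have xc: "x < c" by simp
  have "rs_rows (([a, b, e, f] @ v') @ [x]) = rs_insert (k + 1) x [([e, f] @ v', 1 # 2 # [5..<k + 1]), ([a, b], [3, 4])]"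
    by (rule rs_rows_snoc_eq[OF rsk]) (use lv k in simp)
  also have "\<dots> = (v1 @ x # v2, 1 # 2 # [5..<k + 1]) # rs_insert (k + 1) c [([a, b], [3, 4])]"
    by (simp only: rs_insert.simps c(1) list.case v1_def)
  finally have rsk1: "rs_rows (([a, b, e, f] @ v') @ [x]) =
      (v1 @ x # v2, 1 # 2 # [5..<k + 1]) # rs_insert (k + 1) c [([a, b], [3, 4])]" .
  have rest: "map snd (rs_insert (k + 1) c [([a, b], [3, 4])]) = [[3, 4], [k + 1]]"
    using ord c(2) by auto
  have srt': "sorted_wrt (<) ((v1 @ x # v2) @ xs)"
  proof (rule increasing_if_recorded_in_first_row[OF rsk1, where l = "k + 2" and m = "n + 1"])
    show "sorted_wrt (<) (v1 @ x # v2)" using srt v1 xc unfolding v by (auto simp: sorted_wrt_append)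
    show "recording_tableau ((([a, b, e, f] @ v') @ [x]) @ xs) =
      ((1 # 2 # [5..<k + 1]) @ [k + 2..<n + 1]) # map snd (rs_insert (k + 1) c [([a, b], [3, 4])])"
      unfolding w'[symmetric] rec rest by (simp add: Q_chain_def)
    show "k + 2 = length (([a, b, e, f] @ v') @ [x]) + 1"
      "n + 1 = length (([a, b, e, f] @ v') @ [x]) + length xs + 1" using lv k n by simp_all
  qed
  have wv: "w = [a, b] @ v1 @ c # v2 @ x # xs"
  proof -
    have "w = [a, b] @ ([e, f] @ v') @ [x] @ xs" using w' by simp
    then show ?thesis unfolding v by simp
  qed
  have lead: "(v1 @ c # v2) ! 0 < a" "(v1 @ c # v2) ! 1 < b" "2 \<le> length (v1 @ c # v2)"
    "k = length ([a, b] @ v1 @ c # v2)"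
    unfolding v[symmetric] using ord lv k by simp_all
  have "three_run_word n a b v1 c v2 x xs"
    unfolding three_run_word_def
    using perm[unfolded wv] srt[unfolded v] srt'[unfolded append.assoc append_Cons] ord c(2) xc lead(1-3)
    by blast
  then show thesis using wv lead(4) by (rule that)
qed

lemma permutationI: "set w = {1..n} \<Longrightarrow> distinct w \<Longrightarrow> permutation w \<and> length w = n"
  using distinct_card[of w] by (auto simp: permutation_def permutations_of_set_def)

text \<open>The existence of a word is needed because \<open>sst\<close> is a definite description over the times of
  all words with the given recording tableau.\<close>

lemma sst_good_tableauI:
  assumes "standard_tableau T"
    and "\<exists>w. permutation w \<and> recording_tableau w = T"
    and "\<And>w. permutation w \<Longrightarrow> recording_tableau w = T \<Longrightarrow> steady_state_time w = t \<and> good_permutation w"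
  shows "sst T = t \<and> good_tableau T"
proof -
  have "steady_state_time ` {w. permutation w \<and> recording_tableau w = T} = {t}"
    using assms(2,3) by auto
  then have "sst T = t" unfolding sst_def by auto
  then show ?thesis using assms(1,3) by (auto simp: good_tableau_def)
qed

section \<open>Steady-state times and the Bender--Knuth orbit\<close>

lemma config_of_triple:
  "config_of (x # y # z # d) = triple_config (length d + 3) 1 x 2 y z 4 d"
  by (auto simp: config_of_eq_segment segment_Cons triple_config_def fun_eq_iff numeral_3_eq_3)

lemma config_of_triple_right:
  "config_of (a # b # c # d) = triple_config (length d + 3) (1 + 2) c 1 a b 4 d"
  by (auto simp: config_of_eq_segment segment_Cons triple_config_def fun_eq_iff numeral_3_eq_3)

lemma standard_word_steady_state_time:
  assumes w: "w = x # y # z # d" and std: "standard_tableau [d, [y, z], [x]]"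
  shows "steady_state_time w = 0 \<and> good_permutation w"
proof -
  have n: "length w = length d + 3" "length d = length d + 3 - 3" "3 \<le> length d + 3" using w by simp_all
  show ?thesis
    by (rule steady_state_time_good[OF n(1) _ std n(2,3), of 0 1 2 4])
      (simp_all add: w config_of_triple)
qed

lemma colliding_word_steady_state_time:
  assumes w: "w = a # b # c # d" and col: "colliding d a b c"
  shows "steady_state_time w = 1 \<and> good_permutation w"
proof -
  have n: "length w = length d + 3" "length d = length d + 3 - 3" "3 \<le> length d + 3" using w by simp_all
  have X: "config_of w = triple_config (length d + 3) (1 + 2) c 1 a b 4 d"
    unfolding w by (rule config_of_triple_right)
  show ?thesis
  proof (rule collision[OF col n(2,3), of 1 4])
    fix x y z
    assume std: "standard_tableau [d, [y, z], [x]]"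
      and "BB (length d + 3) (triple_config (length d + 3) (1 + 2) c 1 a b 4 d) =
        triple_config (length d + 3) (1 + 2) x (1 + 3) y z (4 + int (length d)) d"
      and "\<not> steady_state (length d + 3) (triple_config (length d + 3) (1 + 2) c 1 a b 4 d)"
    moreover have "2 \<le> length d" using std standard_tableau_3_iff[OF n(2,3)] by blast
    ultimately show "steady_state_time w = 1 \<and> good_permutation w"
      by (intro steady_state_time_good[OF n(1) _ std n(2,3), of 1 "1 + 2" "1 + 3" "4 + int (length d)"])
        (simp_all add: X)
  qed simp
qed

lemma standard_tableau_Q0: "5 \<le> n \<Longrightarrow> standard_tableau (Q0 n)"
proof -
  assume n: "5 \<le> n"
  have len: "length (1 # 3 # [6..<n + 1]) = n - 3" "3 \<le> n" using n by auto
  have "4 # 2 # 5 # 1 # 3 # [6..<n + 1] \<in> permutations_of_set {1..n}"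
    using n by (auto simp: permutations_of_set_def)
  then show ?thesis using n unfolding Q0_def standard_tableau_3_iff[OF len]
    by (auto simp del: upt_Suc)
qed

lemma standard_tableau_Q2: "5 \<le> n \<Longrightarrow> standard_tableau (Q2 n)"
proof -
  assume n: "5 \<le> n"
  have len: "length (1 # 2 # [6..<n + 1]) = n - 3" "3 \<le> n" using n by auto
  have "4 # 3 # 5 # 1 # 2 # [6..<n + 1] \<in> permutations_of_set {1..n}"
    using n by (auto simp: permutations_of_set_def)
  then show ?thesis using n unfolding Q2_def standard_tableau_3_iff[OF len]
    by (auto simp del: upt_Suc)
qed

lemma standard_tableau_Q_chain:
  assumes k: "4 \<le> k" "k < n" shows "standard_tableau (Q_chain n k)"
proof -
  let ?d = "1 # 2 # [5..<k + 1] @ [k + 2..<n + 1]"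
  have len: "length ?d = n - 3" "3 \<le> n" using k by auto
  have "(k + 1) # 3 # 4 # ?d \<in> permutations_of_set {1..n}"
    using k by (auto simp: permutations_of_set_def)
  then show ?thesis using k unfolding Q_chain_def standard_tableau_3_iff[OF len]
    by (auto simp: sorted_wrt_append)
qed

lemma map_transpose_id: "i \<notin> set r \<Longrightarrow> j \<notin> set r \<Longrightarrow> map (Transposition.transpose i j) r = r"
  by (intro map_idI) (metis transpose_apply_other)

lemma bender_knuth_swap:
  assumes "\<And>r. r \<in> set T \<Longrightarrow> \<not> (i \<in> set r \<and> i + 1 \<in> set r)"
    and "\<And>r s c. r \<in> set T \<Longrightarrow> s \<in> set T \<Longrightarrow> c < length r \<Longrightarrow> c < length s \<Longrightarrow> r ! c = i \<Longrightarrow> s ! c \<noteq> i + 1"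
  shows "bender_knuth i T = map (map (Transposition.transpose i (i + 1))) T"
proof -
  have "\<not> same_row T i (i + 1)" using assms(1) by (auto simp: same_row_def)
  moreover have "\<not> same_column T i (i + 1)" using assms(2) by (auto simp: same_column_def)
  ultimately show ?thesis by (simp add: bender_knuth_def)
qed

lemma bender_knuth_Q0: "bender_knuth 2 (Q0 n) = Q2 n"
proof -
  have "bender_knuth 2 (Q0 n) = map (map (Transposition.transpose 2 (2 + 1))) (Q0 n)"
    by (rule bender_knuth_swap) (auto simp: Q0_def nth_Cons' split: if_splits)
  also have "\<dots> = Q2 n"
    by (simp add: Q0_def Q2_def map_transpose_id Transposition.transpose_def)
  finally show ?thesis .
qed

lemma bender_knuth_Q2: "bender_knuth 4 (Q2 n) = Q_chain n 4"
proof -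
  have "bender_knuth 4 (Q2 n) = map (map (Transposition.transpose 4 (4 + 1))) (Q2 n)"
    by (rule bender_knuth_swap) (auto simp: Q2_def nth_Cons' split: if_splits)
  also have "\<dots> = Q_chain n 4"
    by (simp add: Q2_def Q_chain_def map_transpose_id Transposition.transpose_def)
  finally show ?thesis .
qed

lemma bender_knuth_Q_chain:
  assumes k: "4 \<le> k" "k + 1 < n"
  shows "bender_knuth (k + 1) (Q_chain n k) = Q_chain n (k + 1)"
proof -
  let ?\<tau> = "Transposition.transpose (k + 1) (k + 1 + 1)"
  have "bender_knuth (k + 1) (Q_chain n k) = map (map ?\<tau>) (Q_chain n k)"
  proof (rule bender_knuth_swap)
    show "\<not> (k + 1 \<in> set r \<and> k + 1 + 1 \<in> set r)" if "r \<in> set (Q_chain n k)" for r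
      using that k by (auto simp: Q_chain_def)
    fix r s c
    assume rs: "r \<in> set (Q_chain n k)" "s \<in> set (Q_chain n k)" "c < length r" "c < length s" "r ! c = k + 1"
    then have "k + 1 \<in> set r" by (metis nth_mem)
    then have "r = [k + 1]" using rs(1) k by (auto simp: Q_chain_def)
    \<comment> \<open>The third row is the only one containing \<open>k + 1\<close>, so only the first column matters.\<close>
    then have "c = 0" using rs(3) by simp
    then show "s ! c \<noteq> k + 1 + 1" using rs(2) k by (auto simp: Q_chain_def)
  qed
  also have "\<dots> = Q_chain n (k + 1)"
  proof -
    have "[k + 2..<n + 1] = (k + 2) # [k + 3..<n + 1]" using k
      by (simp add: upt_conv_Cons eval_nat_numeral del: upt_Suc)
    moreover have "map ?\<tau> [5..<k + 1] = [5..<k + 1]" "map ?\<tau> [k + 3..<n + 1] = [k + 3..<n + 1]"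
      by (rule map_transpose_id; simp)+
    moreover have "?\<tau> (k + 2) = k + 1" "?\<tau> (k + 1) = k + 2" "\<And>j. j \<le> k \<Longrightarrow> ?\<tau> j = j"
      by (auto simp: Transposition.transpose_def)
    moreover have "[5..<k + 1 + 1] = [5..<k + 1] @ [k + 1]" using k by simp
    ultimately show ?thesis using k by (simp add: Q_chain_def eval_nat_numeral del: upt_Suc)
  qed
  finally show ?thesis .
qed

text \<open>Each factor \<open>\<sigma>\<^sub>i\<close> after \<open>\<sigma>\<^sub>2\<close> moves the entry of the third row from \<open>i\<close> to
  \<open>i + 1\<close>.\<close>

lemma bender_knuth_product_Q0:
  assumes "4 \<le> k" "k < n"
  shows "bender_knuth_product k (Q0 n) = Q_chain n k"
  using assms
proof (induction k rule: dec_induct)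
  case base
  have "[4..<4 + 1] = [4::nat]" by (simp add: upt_conv_Cons)
  then show ?case unfolding bender_knuth_product_def by (simp only: fold_simps bender_knuth_Q0 bender_knuth_Q2)
next
  case (step k)
  then have "[4..<Suc k + 1] = [4..<k + 1] @ [k + 1]" by simp
  then have "bender_knuth_product (Suc k) (Q0 n) = bender_knuth (k + 1) (bender_knuth_product k (Q0 n))"
    unfolding bender_knuth_product_def by (simp only: fold_simps fold_append o_apply)
  then show ?case using step bender_knuth_Q_chain[of k n] by simp
qed

text \<open>The witness is the row reading word of the tableau whose rows are filled with \<open>1, \<dots>, n\<close> one
  after the other.\<close>

lemma sst_Q0:
  assumes n: "5 \<le> n" shows "sst (Q0 n) = 0 \<and> good_tableau (Q0 n)"
proof (rule sst_good_tableauI[OF standard_tableau_Q0[OF n]])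
  have size: "length (concat (Q0 n)) = n" using n by (simp add: Q0_def del: upt_Suc)
  let ?w = "n # (n - 2) # (n - 1) # [1..<n - 2]"
  have "set ?w = {1..n}" "distinct ?w" using n by auto
  then have w: "permutation ?w" "length ?w = n" using permutationI by blast+
  have len: "length [1..<n - 2] = n - 3" "3 \<le> n" using n by auto
  have "?w \<in> permutations_of_set {1..n}" using w by (simp only: permutation_def)
  then have "standard_tableau [[1..<n - 2], [n - 2, n - 1], [n]]"
    unfolding standard_tableau_3_iff[OF len] using n by auto
  then show "\<exists>w. permutation w \<and> recording_tableau w = Q0 n"
    using recording_Q0_iff[OF n w] w(1) by blast
  fix w assume w: "permutation w" "recording_tableau w = Q0 n"
  then obtain x y z d where "w = x # y # z # d" "standard_tableau [d, [y, z], [x]]"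
    using recording_Q0_iff[OF n w(1) length_eq_if_recording_tableau[OF w(2) size]] by blast
  then show "steady_state_time w = 0 \<and> good_permutation w" by (rule standard_word_steady_state_time)
qed

lemma sst_Q2:
  assumes n: "5 \<le> n" shows "sst (Q2 n) = 1 \<and> good_tableau (Q2 n)"
proof (rule sst_good_tableauI[OF standard_tableau_Q2[OF n]])
  have size: "length (concat (Q2 n)) = n" using n by (simp add: Q2_def del: upt_Suc)
  let ?w = "(n - 1) # n # (n - 2) # [1..<n - 2]"
  have "set ?w = {1..n}" "distinct ?w" using n by auto
  then have w: "permutation ?w" "length ?w = n" using permutationI by blast+
  have len: "length [1..<n - 2] = n - 3" "3 \<le> n" using n by auto
  have "?w \<in> permutations_of_set {1..n}" using w by (simp only: permutation_def)
  then have "(n - 1) # (n - 2) # n # [1..<n - 2] \<in> permutations_of_set {1..n}"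
    by (rule permutations_of_set_cong[THEN iffD1, rotated 2]) auto
  then have "standard_tableau [[1..<n - 2], [n - 2, n], [n - 1]]"
    unfolding standard_tableau_3_iff[OF len] using n by auto
  then have "colliding [1..<n - 2] (n - 1) n (n - 2)" unfolding colliding_def using n by simp
  then show "\<exists>w. permutation w \<and> recording_tableau w = Q2 n"
    using recording_Q2_iff[OF n w] w(1) by blast
  fix w assume w: "permutation w" "recording_tableau w = Q2 n"
  then obtain a b c d where "w = a # b # c # d" "colliding d a b c"
    using recording_Q2_iff[OF n w(1) length_eq_if_recording_tableau[OF w(2) size]] by blast
  then show "steady_state_time w = 1 \<and> good_permutation w" by (rule colliding_word_steady_state_time)
qed

text \<open>The first row is \<open>1, \<dots>, n - 3\<close> again, and \<open>x = k - 2\<close> bumps the letter \<open>c = n - 2\<close> at the end of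
  the second run.\<close>

lemma three_run_word_exists:
  assumes k: "4 \<le> k" "k < n"
  shows "three_run_word n (n - 1) n [1..<k - 2] (n - 2) [] (k - 2) [k - 1..<n - 2]"
  unfolding three_run_word_def
proof (intro conjI)
  let ?v = "[1..<k - 2] @ (n - 2) # []"
  show "[n - 1, n] @ [1..<k - 2] @ (n - 2) # [] @ (k - 2) # [k - 1..<n - 2] \<in> permutations_of_set {1..n}"
    using k by (auto simp: permutations_of_set_def)
  show "?v ! 0 < n - 1" using k by (auto simp: nth_append)
  show "?v ! 1 < n" using k by (auto simp: nth_append)
qed (use k in \<open>auto simp: sorted_wrt_append\<close>)

lemma sst_Q_chain:
  assumes k: "4 \<le> k" "k < n" shows "sst (Q_chain n k) = k - 2 \<and> good_tableau (Q_chain n k)"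
proof (rule sst_good_tableauI[OF standard_tableau_Q_chain[OF k]])
  have size: "length (concat (Q_chain n k)) = n" using k by (simp add: Q_chain_def del: upt_Suc)
  let ?w = "[n - 1, n] @ [1..<k - 2] @ (n - 2) # [] @ (k - 2) # [k - 1..<n - 2]"
  have wd: "three_run_word n (n - 1) n [1..<k - 2] (n - 2) [] (k - 2) [k - 1..<n - 2]"
    by (rule three_run_word_exists[OF k])
  have "?w \<in> permutations_of_set {1..n}" using wd unfolding three_run_word_def by blast
  then have "permutation ?w" using permutationI permutations_of_setD by blast
  moreover have "k = length ([n - 1, n] @ [1..<k - 2] @ (n - 2) # [])" using k by simp
  ultimately show "\<exists>w. permutation w \<and> recording_tableau w = Q_chain n k"
    using recording_Q_chain_if_three_run_word[OF wd] by metis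
  fix w assume w: "permutation w" "recording_tableau w = Q_chain n k"
  obtain a b v1 c v2 x xs where "three_run_word n a b v1 c v2 x xs"
    "w = [a, b] @ v1 @ c # v2 @ x # xs" "k = length ([a, b] @ v1 @ c # v2)"
    by (rule three_run_word_if_recording_Q_chain[OF k w(1) length_eq_if_recording_tableau[OF w(2) size] w(2)])
  then show "steady_state_time w = k - 2 \<and> good_permutation w"
    using three_run_word_steady_state_time[of n a b v1 c v2 x xs] by simp
qed

theorem proposition7p8:
  fixes n :: nat
  assumes "n \<ge> 5"
  shows "sst (Q0 n) = 0
    \<and> sst (bender_knuth 2 (Q0 n)) = 1
    \<and> (\<forall>k\<in>{4..n - 1}. sst (bender_knuth_product k (Q0 n)) = k - 2)
    \<and> good_tableau (Q0 n)
    \<and> good_tableau (bender_knuth 2 (Q0 n))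
    \<and> (\<forall>k\<in>{4..n - 1}. good_tableau (bender_knuth_product k (Q0 n)))"
proof -
  have "sst (bender_knuth_product k (Q0 n)) = k - 2 \<and> good_tableau (bender_knuth_product k (Q0 n))"
    if "k \<in> {4..n - 1}" for k
  proof -
    have k: "4 \<le> k" "k < n" using that assms by auto
    show ?thesis unfolding bender_knuth_product_Q0[OF k] by (rule sst_Q_chain[OF k])
  qed
  then show ?thesis
    using sst_Q0[OF assms] sst_Q2[OF assms] unfolding bender_knuth_Q0 by blast
qed

end
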